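(* Let $n = 9$ and let $C$ be a cubic form in $9$ variables as in the context satisfying Davenport's Geometric Condition. Assume moreover the following hypothesis: for every integer $0 \le r \le 9$ and every $\varepsilon>0$, uniformly for all real $1 \le H \le R$, \[ \#\{(\mathbf{h},p) : \mathbf{h}\in\mathbb{Z}^9,\ \|\mathbf{h}\|_\infty \le H,\ p \text{ prime},\ R < p \le 2R,\ r_p(\mathbf{h}) \le r\} \ll_\varepsilon H^r R^{1+\varepsilon}. \] Then the singular series is absolutely convergent, i.e. $\sum_{q\ge 1}\sum_{\gcd(a,q)=1} |S(q,a)|/q^9 < \infty$.
   Context: Let $C(\mathbf{x}) = \sum_{i,j,k=1}^n c_{ijk} x_i x_j x_k$ be a cubic form with integer coefficients $c_{ijk}$ that are symmetric in $i,j,k$. Let $M(\mathbf{x})$ be the $n\times n$ matrix with entries $M(\mathbf{x})_{jk} = \sum_{i=1}^n c_{ijk} x_i$; $r(\mathbf{x})$ denotes its rank over $\mathbb{Q}$ and, for a prime $p$, $r_p(\mathbf{x})$ denotes the rank over $\mathbb{F}_p$ of its reduction mod $p$. $C$ satisfies Davenport's Geometric Condition if for every integer $0 \le r \le n$ and every $\varepsilon>0$, $\#\{\mathbf{x} \in \mathbb{Z}^n : \|\mathbf{x}\|_\infty \le P,\ r(\mathbf{x}) = r\} \ll_{\varepsilon} P^{r+\varepsilon}$ for all $P\ge1$. Write $e(x)=e^{2\pi i x}$ and $S(q,a) = \sum_{\mathbf{x} \bmod q} e(aC(\mathbf{x})/q)$. *)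

theory Defs
  imports "HOL-Analysis.Analysis" "HOL-Computational_Algebra.Primes"
    "Jordan_Normal_Form.DL_Rank" "Jordan_Normal_Form.DL_Submatrix"
begin

text \<open>Coefficients c i j k with indices 0..n-1 (n = 9 here); vectors x :: nat => int with
  x i = 0 for i >= n.\<close>

definition cubic_form :: "nat \<Rightarrow> (nat \<Rightarrow> nat \<Rightarrow> nat \<Rightarrow> int) \<Rightarrow> (nat \<Rightarrow> int) \<Rightarrow> int" where
  "cubic_form n c x = (\<Sum>i<n. \<Sum>j<n. \<Sum>k<n. c i j k * x i * x j * x k)"

definition symmetric_coeffs :: "nat \<Rightarrow> (nat \<Rightarrow> nat \<Rightarrow> nat \<Rightarrow> int) \<Rightarrow> bool" where
  "symmetric_coeffs n c \<longleftrightarrow> (\<forall>i<n. \<forall>j<n. \<forall>k<n. c i j k = c j i k \<and> c i j k = c i k j)"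

definition Mmat :: "nat \<Rightarrow> (nat \<Rightarrow> nat \<Rightarrow> nat \<Rightarrow> int) \<Rightarrow> (nat \<Rightarrow> int) \<Rightarrow> int mat" where
  "Mmat n c x = mat n n (\<lambda>(j,k). \<Sum>i<n. c i j k * x i)"

definition rank_Q :: "nat \<Rightarrow> (nat \<Rightarrow> nat \<Rightarrow> nat \<Rightarrow> int) \<Rightarrow> (nat \<Rightarrow> int) \<Rightarrow> nat" where
  "rank_Q n c x = vec_space.rank n (map_mat (of_int :: int \<Rightarrow> rat) (Mmat n c x))"

text \<open>Rank over F_p of the reduction mod p: largest size of a square minor that is
  nonzero mod p.\<close>
definition rank_mod :: "nat \<Rightarrow> nat \<Rightarrow> (nat \<Rightarrow> nat \<Rightarrow> nat \<Rightarrow> int) \<Rightarrow> (nat \<Rightarrow> int) \<Rightarrow> nat" where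
  "rank_mod p n c x = Max {k. \<exists>I J. I \<subseteq> {..<n} \<and> J \<subseteq> {..<n} \<and> card I = k \<and> card J = k \<and>
        \<not> (int p dvd det (submatrix (Mmat n c x) I J))}"

definition box :: "nat \<Rightarrow> real \<Rightarrow> (nat \<Rightarrow> int) set" where
  "box n P = {x. (\<forall>i. n \<le> i \<longrightarrow> x i = 0) \<and> (\<forall>i<n. \<bar>real_of_int (x i)\<bar> \<le> P)}"

definition davenport_geometric :: "nat \<Rightarrow> (nat \<Rightarrow> nat \<Rightarrow> nat \<Rightarrow> int) \<Rightarrow> bool" where
  "davenport_geometric n c \<longleftrightarrow>
     (\<forall>r\<le>n. \<forall>\<epsilon>>0. \<exists>K. \<forall>P\<ge>1.
        real (card {x \<in> box n P. rank_Q n c x = r}) \<le> K * P powr (real r + \<epsilon>))"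

definition e :: "real \<Rightarrow> complex" where
  "e t = cis (2 * pi * t)"

text \<open>S(q,a): sum over x in (Z/qZ)^n, represented by residues 0..q-1.\<close>
definition S :: "nat \<Rightarrow> (nat \<Rightarrow> nat \<Rightarrow> nat \<Rightarrow> int) \<Rightarrow> nat \<Rightarrow> nat \<Rightarrow> complex" where
  "S n c q a = (\<Sum>x \<in> {x. (\<forall>i. n \<le> i \<longrightarrow> x i = 0) \<and> (\<forall>i<n. 0 \<le> x i \<and> x i < int q)}.
       e (real a * real_of_int (cubic_form n c x) / real q))"

end

theory Submission
  imports Defs "HOL-Number_Theory.Cong"
begin

text \<open>
  Put F(q) = q^(1-n) max |S(q,a)|, the maximum being over a coprime to q. F is submultiplicative on
  coprime moduli, so the sum of F(q) is at most an Euler product and it is enough to bound the sum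
  of F(p^k) over all p and k.

  Averaging over shifts of size H before the Cauchy--Schwarz inequality and then squaring once more gives
  |S(q,a)|^2 <= q^n H^(-n) sum over |h| <= H of (q^n N_q(h))^(1/2),
  where N_q(h) is the number of y mod q with 6 M(h) y = 0 mod q.
  If M(h) has rational rank r, then N_q(h) is of order at most H^r q^(n-r): by the pigeonhole principle
  it is at most (LH)^n times the number of d with |d| < q/(LH) and 6 M(h) d = 0 mod q, and for a large
  constant L such a d satisfies M(h) d = 0. With H = q^(1/3), Davenport's condition yields
  S(q,a) = O(q^(5n/6+\<epsilon>)), hence F(q) = O(q^(-1/2+\<epsilon>)) for n = 9, which settles all k >= 3.
  For k = 1, 2 and p in (R, 2R] take H = R: here N_q(h) <= q^(n-r) with r the rank of M(h) mod p,
  and the averaged hypothesis bounds the sum of F(p^k) over these p by R^(1-5k/4+\<epsilon>).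
\<close>

section \<open>Integer vectors and additive characters\<close>

text \<open>With Davenport's count, the h of rank r contribute q^(2n) H^(-n) (H^3/q)^(r/2) to the
  estimate of |S(q,a)|^2, up to q^\<epsilon>. Hence H = q^(1/3): there all ranks weigh the same,
  while r = 0 governs shorter shifts and r = n longer ones. The obstacle is k = 1 and k = 2: a bound
  of order q^(-1/2) for F leaves p^(-1/2) and p^(-1), neither summable over the primes. The kernel
  bound by the rank mod p carries no factor H^r, so on average over p rank r contributes only q^(2n)
  H^(-n) (H^2/q)^(r/2), and full rank dominates once H^2 is at least of order q. The choice H = R,
  the longest range that the averaged hypothesis admits, reaches this precisely for k <= 2. Full
  rank gives |S|^2 of order q^(3n/2), that is F of order q^(1-n/4). Splitting q into coprime factors
  changes a, which is why F contains a maximum over a. The maximum costs nothing, because the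
  differencing bound sees a only through its coprimality to q.\<close>

definition fvec :: "nat set \<Rightarrow> int set \<Rightarrow> (nat \<Rightarrow> int) set" where
  "fvec A V = {x. (\<forall>i. i \<notin> A \<longrightarrow> x i = 0) \<and> (\<forall>i\<in>A. x i \<in> V)}"

lemma bij_betw_fvec: "bij_betw (\<lambda>x. restrict x A) (fvec A V) (A \<rightarrow>\<^sub>E V)"
  by (rule bij_betw_byWitness[where f' = "\<lambda>f i. if i \<in> A then f i else 0"])
     (auto simp: fvec_def PiE_def extensional_def fun_eq_iff restrict_def)

lemma card_fvec: "finite A \<Longrightarrow> card (fvec A V) = card V ^ card A"
  using bij_betw_same_card[OF bij_betw_fvec[of A V]] by (simp add: card_PiE)

lemma finite_fvec: "finite A \<Longrightarrow> finite V \<Longrightarrow> finite (fvec A V)"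
  using bij_betw_finite[OF bij_betw_fvec[of A V]] finite_PiE[of A "\<lambda>_. V"] by blast

text \<open>Setting the coordinates in \<open>J\<close> to zero is injective on \<open>Y\<close>.
  Both kernel counts end here: \<open>J\<close> is the column set of a unit minor modulo p^k in one,
  and a set of columns independent over the rationals in the other.\<close>

lemma card_le_determined_coordinates:
  assumes Y: "Y \<subseteq> fvec {..<n} V" and V: "finite V" and J: "J \<subseteq> {..<n}"
    and det: "\<And>y y'. y \<in> Y \<Longrightarrow> y' \<in> Y \<Longrightarrow> (\<And>i. i \<notin> J \<Longrightarrow> y i = y' i) \<Longrightarrow> y = y'"
  shows "card Y \<le> card V ^ (n - card J)"
proof -
  define f where "f = (\<lambda>(y :: nat \<Rightarrow> int) i. if i \<in> J then 0 else y i)"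
  have "inj_on f Y"
    by (rule inj_onI, rule det) (auto simp: f_def fun_eq_iff split: if_splits)
  moreover have "f ` Y \<subseteq> fvec ({..<n} - J) V"
    using Y by (auto simp: f_def fvec_def)
  ultimately have "card Y \<le> card (fvec ({..<n} - J) V)"
    by (intro card_inj_on_le finite_fvec V) auto
  also have "\<dots> = card V ^ (n - card J)"
    using J by (simp add: card_fvec card_Diff_subset finite_subset)
  finally show ?thesis .
qed

definition residue_vectors :: "nat \<Rightarrow> nat \<Rightarrow> (nat \<Rightarrow> int) set" where
  "residue_vectors n q = {x. (\<forall>i. n \<le> i \<longrightarrow> x i = 0) \<and> (\<forall>i<n. 0 \<le> x i \<and> x i < int q)}"

lemma residue_vectors_fvec: "residue_vectors n q = fvec {..<n} {0..<int q}"
  by (auto simp: residue_vectors_def fvec_def not_less)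

lemma finite_residue_vectors [simp]: "finite (residue_vectors n q)"
  by (simp add: residue_vectors_fvec finite_fvec)

lemma card_residue_vectors [simp]: "card (residue_vectors n q) = q ^ n"
  by (simp add: residue_vectors_fvec card_fvec)

lemma box_fvec: "box n P = fvec {..<n} {-\<lfloor>P\<rfloor>..\<lfloor>P\<rfloor>}"
proof -
  have "\<bar>real_of_int z\<bar> \<le> P \<longleftrightarrow> z \<in> {-\<lfloor>P\<rfloor>..\<lfloor>P\<rfloor>}" for z
    by (auto simp: le_floor_iff abs_le_iff minus_le_iff)
  then show ?thesis
    by (auto simp: box_def fvec_def not_less)
qed

lemma finite_box [simp]: "finite (box n P)"
  by (simp add: box_fvec finite_fvec)

section \<open>Polarization of the cubic form\<close>

definition trilinear :: "nat \<Rightarrow> (nat \<Rightarrow> nat \<Rightarrow> nat \<Rightarrow> int) \<Rightarrow> (nat \<Rightarrow> int) \<Rightarrow> (nat \<Rightarrow> int) \<Rightarrow> (nat \<Rightarrow> int) \<Rightarrow> int" where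
  "trilinear n c x y z = (\<Sum>i<n. \<Sum>j<n. \<Sum>k<n. c i j k * x i * y j * z k)"

lemma trilinear_add:
  "trilinear n c (\<lambda>i. x i + x' i) y z = trilinear n c x y z + trilinear n c x' y z"
  "trilinear n c x (\<lambda>i. y i + y' i) z = trilinear n c x y z + trilinear n c x y' z"
  "trilinear n c x y (\<lambda>i. z i + z' i) = trilinear n c x y z + trilinear n c x y z'"
  by (simp_all add: trilinear_def algebra_simps sum.distrib)

lemma trilinear_scale:
  "trilinear n c (\<lambda>i. m * x i) y z = m * trilinear n c x y z"
  "trilinear n c x (\<lambda>i. m * y i) z = m * trilinear n c x y z"
  "trilinear n c x y (\<lambda>i. m * z i) = m * trilinear n c x y z"
  by (simp_all add: trilinear_def sum_distrib_left algebra_simps)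

lemma trilinear_swap23:
  assumes "symmetric_coeffs n c"
  shows "trilinear n c x y z = trilinear n c x z y"
proof -
  have "trilinear n c x y z = (\<Sum>i<n. \<Sum>j<n. \<Sum>k<n. c i k j * x i * z k * y j)"
    unfolding trilinear_def using assms
    by (intro sum.cong refl) (auto simp: symmetric_coeffs_def)
  also have "\<dots> = trilinear n c x z y"
    unfolding trilinear_def by (intro sum.cong refl sum.swap)
  finally show ?thesis .
qed

lemma trilinear_swap12:
  assumes "symmetric_coeffs n c"
  shows "trilinear n c x y z = trilinear n c y x z"
proof -
  have "trilinear n c x y z = (\<Sum>i<n. \<Sum>j<n. \<Sum>k<n. c j i k * y j * x i * z k)"
    unfolding trilinear_def using assms
    by (intro sum.cong refl) (auto simp: symmetric_coeffs_def)
  also have "\<dots> = trilinear n c y x z"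
    unfolding trilinear_def by (rule sum.swap)
  finally show ?thesis .
qed

lemma cubic_form_trilinear: "cubic_form n c x = trilinear n c x x x"
  by (simp add: cubic_form_def trilinear_def)

text \<open>Two differences remove the parts of degree 3 and 2 in \<open>x\<close>. A linear part
  remains, with the factor 6 = 3! from the orderings of three arguments, together with terms free of
  \<open>x\<close>.\<close>

lemma cubic_form_second_difference:
  assumes "symmetric_coeffs n c"
  shows "cubic_form n c (\<lambda>i. x i + y i + d i) - cubic_form n c (\<lambda>i. x i + y i)
      - cubic_form n c (\<lambda>i. x i + d i) + cubic_form n c x
    = 6 * trilinear n c x y d + (3 * trilinear n c y y d + 3 * trilinear n c y d d)"
proof -
  note s12 = trilinear_swap12[OF assms] and s23 = trilinear_swap23[OF assms]
  have "trilinear n c x d y = trilinear n c x y d" "trilinear n c y x d = trilinear n c x y d"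
    "trilinear n c y d x = trilinear n c x y d" "trilinear n c d x y = trilinear n c x y d"
    "trilinear n c d y x = trilinear n c x y d"
    using s12[of x y d] s12[of x d y] s23[of x d y] s23[of y d x] s23[of d y x] by simp_all
  moreover have "trilinear n c y d y = trilinear n c y y d" "trilinear n c d y y = trilinear n c y y d"
    "trilinear n c d y d = trilinear n c y d d" "trilinear n c d d y = trilinear n c y d d"
    using s12[of y d y] s23[of y d y] s12[of d y d] s23[of d d y] by simp_all
  ultimately show ?thesis
    unfolding cubic_form_trilinear trilinear_add by simp
qed

definition Mvec :: "nat \<Rightarrow> (nat \<Rightarrow> nat \<Rightarrow> nat \<Rightarrow> int) \<Rightarrow> (nat \<Rightarrow> int) \<Rightarrow> (nat \<Rightarrow> int) \<Rightarrow> nat \<Rightarrow> int" where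
  "Mvec n c h y j = (\<Sum>k<n. Mmat n c h $$ (j, k) * y k)"

text \<open>By symmetry \<open>h\<close> may take the slot that M contracts. The form then becomes a
  linear functional of \<open>x\<close> whose coefficient vector is M(h)y.\<close>

lemma trilinear_Mvec:
  assumes "symmetric_coeffs n c"
  shows "trilinear n c x y h = (\<Sum>j<n. x j * Mvec n c h y j)"
proof -
  have "trilinear n c x y h = trilinear n c h x y"
    using trilinear_swap12[OF assms] trilinear_swap23[OF assms] by metis
  also have "\<dots> = (\<Sum>j<n. \<Sum>i<n. \<Sum>k<n. c i j k * h i * x j * y k)"
    unfolding trilinear_def by (rule sum.swap)
  also have "\<dots> = (\<Sum>j<n. \<Sum>k<n. \<Sum>i<n. c i j k * h i * x j * y k)"
    by (intro sum.cong refl sum.swap)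
  also have "\<dots> = (\<Sum>j<n. x j * Mvec n c h y j)"
    by (simp add: Mvec_def Mmat_def sum_distrib_left sum_distrib_right mult_ac)
  finally show ?thesis .
qed

lemma cong_trilinear:
  assumes "\<And>i. [x i = x' i] (mod m)" "\<And>i. [y i = y' i] (mod m)" "\<And>i. [z i = z' i] (mod m)"
  shows "[trilinear n c x y z = trilinear n c x' y' z'] (mod m)"
  unfolding trilinear_def by (intro cong_sum cong_mult assms cong_refl)

text \<open>Translation by \<open>h\<close> permutes the residue classes; on representatives it is
  translation followed by reduction mod \<open>q\<close>, and \<open>per\<close> makes the reduction
  invisible to \<open>g\<close>.\<close>

lemma sum_residue_vectors_shift:
  fixes g :: "(nat \<Rightarrow> int) \<Rightarrow> 'a :: comm_monoid_add"
  assumes q: "q > 0" and per: "\<And>x y. (\<And>i. [x i = y i] (mod int q)) \<Longrightarrow> g x = g y"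
    and h: "\<And>i. n \<le> i \<Longrightarrow> h i = 0"
  shows "(\<Sum>x\<in>residue_vectors n q. g (\<lambda>i. x i + h i)) = (\<Sum>x\<in>residue_vectors n q. g x)"
proof (rule sum.reindex_bij_witness[where
      j = "\<lambda>x i. (x i + h i) mod int q" and i = "\<lambda>x i. (x i - h i) mod int q"])
  fix x assume x: "x \<in> residue_vectors n q"
  show "(\<lambda>i. ((x i + h i) mod int q - h i) mod int q) = x"
  proof
    fix i show "((x i + h i) mod int q - h i) mod int q = x i"
      using x h[of i] by (cases "i < n") (auto simp: residue_vectors_def mod_simps)
  qed
  show "(\<lambda>i. (x i + h i) mod int q) \<in> residue_vectors n q"
    using x q h by (auto simp: residue_vectors_def)
  show "g (\<lambda>i. (x i + h i) mod int q) = g (\<lambda>i. x i + h i)"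
    by (rule per) (simp add: cong_def)
next
  fix x assume x: "x \<in> residue_vectors n q"
  show "(\<lambda>i. ((x i - h i) mod int q + h i) mod int q) = x"
  proof
    fix i show "((x i - h i) mod int q + h i) mod int q = x i"
      using x h[of i] by (cases "i < n") (auto simp: residue_vectors_def mod_simps)
  qed
  show "(\<lambda>i. (x i - h i) mod int q) \<in> residue_vectors n q"
    using x q h by (auto simp: residue_vectors_def)
qed

section \<open>Additive characters modulo q and their orthogonality\<close>

definition ez :: "nat \<Rightarrow> int \<Rightarrow> complex" where
  "ez q m = e (real_of_int m / real q)"

lemma ez_add: "ez q (m + m') = ez q m * ez q m'"
  by (simp add: ez_def e_def cis_mult add_divide_distrib distrib_left)

lemma norm_ez [simp]: "cmod (ez q m) = 1"
  by (simp add: ez_def e_def)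

lemma cnj_ez: "cnj (ez q m) = ez q (- m)"
  by (simp add: ez_def e_def cis_cnj)

lemma ez_eq_1_iff:
  assumes "q > 0"
  shows "ez q m = 1 \<longleftrightarrow> int q dvd m"
proof
  assume "int q dvd m"
  then obtain k where "m = int q * k" ..
  then show "ez q m = 1"
    using assms by (simp add: ez_def e_def cis_multiple_2pi)
next
  assume "ez q m = 1"
  then have "cos (2 * pi * (real_of_int m / real q)) = 1"
    by (auto simp: ez_def e_def complex_eq_iff)
  then obtain k :: int where "2 * pi * (real_of_int m / real q) = of_int k * 2 * pi"
    using cos_one_2pi_int by blast
  then have "real_of_int m = of_int k * real q"
    using assms by (simp add: field_simps)
  then have "m = k * int q"
    by (metis of_int_eq_iff of_int_mult of_int_of_nat_eq)
  then show "int q dvd m" by simp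
qed

lemma ez_cong:
  assumes "q > 0" "[m = m'] (mod int q)"
  shows "ez q m = ez q m'"
proof -
  have "ez q (m - m') = 1"
    using assms ez_eq_1_iff by (simp add: cong_iff_dvd_diff)
  then show ?thesis
    using ez_add[of q "m - m'" m'] by simp
qed

lemma S_ez: "S n c q a = (\<Sum>x\<in>residue_vectors n q. ez q (int a * cubic_form n c x))"
  by (simp add: S_def residue_vectors_def ez_def)

text \<open>Shifting the j-th coordinate by 1 multiplies the sum by a factor different from 1.\<close>

lemma sum_ez_linear_eq_0:
  assumes q: "q > 0" and j: "j < n" and b: "\<not> int q dvd b j"
  shows "(\<Sum>x\<in>residue_vectors n q. ez q (\<Sum>i<n. x i * b i)) = 0"
proof -
  let ?g = "\<lambda>x. ez q (\<Sum>i<n. x i * b i)"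
  have "(\<Sum>i<n. (x i + (if i = j then 1 else 0)) * b i) = (\<Sum>i<n. x i * b i) + b j" for x
    using j by (simp add: distrib_right sum.distrib if_distrib[of "\<lambda>u. u * _"] cong: if_cong)
  then have "sum ?g (residue_vectors n q) * ez q (b j)
      = (\<Sum>x\<in>residue_vectors n q. ?g (\<lambda>i. x i + (if i = j then 1 else 0)))"
    by (simp add: ez_add sum_distrib_right)
  also have "\<dots> = sum ?g (residue_vectors n q)"
    using j q by (intro sum_residue_vectors_shift ez_cong cong_sum cong_mult) auto
  finally have "sum ?g (residue_vectors n q) * (ez q (b j) - 1) = 0"
    by (simp add: right_diff_distrib)
  then show ?thesis
    using b ez_eq_1_iff[OF q] by simp
qed

section \<open>Van der Corput and Weyl differencing\<close>

text \<open>The 6 is the one of the second difference. It is a unit modulo powers of primes above 3,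
  and elsewhere it only enlarges a constant.\<close>

definition kernel_count :: "nat \<Rightarrow> (nat \<Rightarrow> nat \<Rightarrow> nat \<Rightarrow> int) \<Rightarrow> nat \<Rightarrow> (nat \<Rightarrow> int) \<Rightarrow> nat" where
  "kernel_count n c q h = card {y \<in> residue_vectors n q. \<forall>j<n. int q dvd 6 * Mvec n c h y j}"

definition phase :: "nat \<Rightarrow> (nat \<Rightarrow> nat \<Rightarrow> nat \<Rightarrow> int) \<Rightarrow> nat \<Rightarrow> nat \<Rightarrow> (nat \<Rightarrow> int) \<Rightarrow> complex" where
  "phase n c q a x = ez q (int a * cubic_form n c x)"

lemma phase_cong:
  assumes "q > 0" "\<And>i. [x i = y i] (mod int q)"
  shows "phase n c q a x = phase n c q a y"
  unfolding phase_def cubic_form_trilinear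
  by (intro ez_cong cong_mult cong_trilinear cong_refl assms)

definition correlation :: "nat \<Rightarrow> (nat \<Rightarrow> nat \<Rightarrow> nat \<Rightarrow> int) \<Rightarrow> nat \<Rightarrow> nat \<Rightarrow> (nat \<Rightarrow> int) \<Rightarrow> complex" where
  "correlation n c q a d =
     (\<Sum>x\<in>residue_vectors n q. phase n c q a (\<lambda>i. x i + d i) * cnj (phase n c q a x))"

lemma correlation_shift:
  assumes q: "q > 0" and h': "\<And>i. n \<le> i \<Longrightarrow> h' i = 0"
  shows "(\<Sum>x\<in>residue_vectors n q. phase n c q a (\<lambda>i. x i + h i) * cnj (phase n c q a (\<lambda>i. x i + h' i)))
    = correlation n c q a (\<lambda>i. h i - h' i)"
proof -
  let ?g = "\<lambda>x. phase n c q a (\<lambda>i. x i + (h i - h' i)) * cnj (phase n c q a x)"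
  have "(\<Sum>x\<in>residue_vectors n q. ?g (\<lambda>i. x i + h' i)) = (\<Sum>x\<in>residue_vectors n q. ?g x)"
  proof (rule sum_residue_vectors_shift[OF q _ h'])
    fix x y :: "nat \<Rightarrow> int" assume "\<And>i. [x i = y i] (mod int q)"
    then show "?g x = ?g y"
      by (intro arg_cong2[where f = "(*)"] arg_cong[where f = cnj] phase_cong q cong_add cong_refl)
  qed
  then show ?thesis
    by (simp add: correlation_def)
qed

text \<open>In the squared correlation the phase of each term is linear in \<open>x\<close> for
  fixed \<open>y\<close>, so the sum over \<open>x\<close> vanishes unless every linear coefficient
  is divisible by \<open>q\<close>. Since \<open>a\<close> is invertible mod \<open>q\<close>, this
  condition does not involve \<open>a\<close>.\<close>

lemma norm_correlation_le:
  assumes sym: "symmetric_coeffs n c" and q: "q > 0" and a: "coprime a q"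
    and d: "\<And>i. n \<le> i \<Longrightarrow> d i = 0"
  shows "(cmod (correlation n c q a d))\<^sup>2 \<le> real q ^ n * real (kernel_count n c q d)"
proof -
  let ?V = "residue_vectors n q"
  define g where "g = (\<lambda>x. phase n c q a (\<lambda>i. x i + d i) * cnj (phase n c q a x))"
  define P where "P = (\<lambda>y. \<forall>j<n. int q dvd 6 * Mvec n c d y j)"
  have g_cong: "g x = g y" if "\<And>i. [x i = y i] (mod int q)" for x y
    unfolding g_def
    by (intro arg_cong2[where f = "(*)"] arg_cong[where f = cnj] phase_cong q cong_add cong_refl that)
  have "correlation n c q a d * cnj (correlation n c q a d) = (\<Sum>x\<in>?V. (\<Sum>y\<in>?V. g y) * cnj (g x))"
    by (simp add: correlation_def g_def cnj_sum sum_distrib_left)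
  \<comment> \<open>Substituting y + x for y makes the difference of the two variables the outer
    variable once the sums are exchanged.\<close>
  also have "\<dots> = (\<Sum>x\<in>?V. (\<Sum>y\<in>?V. g (\<lambda>i. y i + x i)) * cnj (g x))"
  proof (rule sum.cong[OF refl])
    fix x assume "x \<in> ?V"
    then have "(\<Sum>y\<in>?V. g (\<lambda>i. y i + x i)) = (\<Sum>y\<in>?V. g y)"
      by (intro sum_residue_vectors_shift q g_cong) (auto simp: residue_vectors_def)
    then show "(\<Sum>y\<in>?V. g y) * cnj (g x) = (\<Sum>y\<in>?V. g (\<lambda>i. y i + x i)) * cnj (g x)"
      by simp
  qed
  also have "\<dots> = (\<Sum>y\<in>?V. \<Sum>x\<in>?V. g (\<lambda>i. y i + x i) * cnj (g x))"
    unfolding sum_distrib_right by (rule sum.swap)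
  finally have sq: "correlation n c q a d * cnj (correlation n c q a d)
      = (\<Sum>y\<in>?V. \<Sum>x\<in>?V. g (\<lambda>i. y i + x i) * cnj (g x))" .
  have inner: "cmod (\<Sum>x\<in>?V. g (\<lambda>i. y i + x i) * cnj (g x)) \<le> (if P y then real q ^ n else 0)" for y
  proof -
    \<comment> \<open>\<open>K\<close> collects the part of the phase that is free of
      \<open>x\<close>; it contributes a factor of modulus 1. The \<open>b j\<close> are the linear
      coefficients.\<close>
    define K where "K = int a * (3 * trilinear n c y y d + 3 * trilinear n c y d d)"
    define b where "b = (\<lambda>j. int a * (6 * Mvec n c d y j))"
    have expand: "g (\<lambda>i. y i + x i) * cnj (g x) = ez q (\<Sum>j<n. x j * b j) * ez q K" for x
    proof -
      have "g (\<lambda>i. y i + x i) * cnj (g x) = ez q (int a *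
          (cubic_form n c (\<lambda>i. x i + y i + d i) - cubic_form n c (\<lambda>i. x i + y i)
           - cubic_form n c (\<lambda>i. x i + d i) + cubic_form n c x))"
        by (simp add: g_def phase_def cnj_ez ez_add[symmetric] add_ac algebra_simps)
      also have "int a * (cubic_form n c (\<lambda>i. x i + y i + d i) - cubic_form n c (\<lambda>i. x i + y i)
           - cubic_form n c (\<lambda>i. x i + d i) + cubic_form n c x) = (\<Sum>j<n. x j * b j) + K"
        unfolding cubic_form_second_difference[OF sym] trilinear_Mvec[OF sym, of x y d]
        by (simp add: b_def K_def sum_distrib_left algebra_simps)
      finally show ?thesis by (simp add: ez_add)
    qed
    have "cmod (\<Sum>x\<in>?V. g (\<lambda>i. y i + x i) * cnj (g x)) = cmod (\<Sum>x\<in>?V. ez q (\<Sum>j<n. x j * b j))"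
      unfolding expand sum_distrib_right[symmetric] by (simp add: norm_mult)
    also have "\<dots> \<le> (if P y then real q ^ n else 0)"
    proof (cases "P y")
      case True
      have "cmod (\<Sum>x\<in>?V. ez q (\<Sum>j<n. x j * b j)) \<le> (\<Sum>x\<in>?V. 1)"
        by (rule order_trans[OF norm_sum]) simp
      then show ?thesis using True by simp
    next
      case False
      then obtain j where j: "j < n" "\<not> int q dvd 6 * Mvec n c d y j" by (auto simp: P_def)
      have "coprime (int q) (int a)" using a by (simp add: ac_simps)
      then have "\<not> int q dvd b j" using j by (simp add: b_def coprime_dvd_mult_right_iff)
      then show ?thesis using sum_ez_linear_eq_0[OF q j(1)] False by simp
    qed
    finally show ?thesis .
  qed
  have "(cmod (correlation n c q a d))\<^sup>2 = cmod (correlation n c q a d * cnj (correlation n c q a d))"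
    by (simp add: norm_mult power2_eq_square)
  also have "\<dots> \<le> (\<Sum>y\<in>?V. cmod (\<Sum>x\<in>?V. g (\<lambda>i. y i + x i) * cnj (g x)))"
    unfolding sq by (rule norm_sum)
  also have "\<dots> \<le> (\<Sum>y\<in>?V. if P y then real q ^ n else 0)"
    by (intro sum_mono inner)
  also have "\<dots> = real q ^ n * real (kernel_count n c q d)"
    by (simp add: sum.If_cases kernel_count_def P_def Int_def)
  finally show ?thesis .
qed

lemma sum_norm_squared_le:
  fixes f :: "'a \<Rightarrow> real"
  assumes "finite A"
  shows "(sum f A)\<^sup>2 \<le> real (card A) * (\<Sum>x\<in>A. (f x)\<^sup>2)"
  using Cauchy_Schwarz_ineq_sum[of "\<lambda>_. 1" f A] by simp

text \<open>Squaring directly would bring in all q^n differences. After averaging over H^n shifts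
  only differences in a box of size \<open>H\<close> occur, and the rank statistics concern such
  short vectors.\<close>

theorem van_der_Corput_Weyl:
  assumes sym: "symmetric_coeffs n c" and q: "q > 0" and a: "coprime a q" and H: "H > 0"
  shows "(cmod (S n c q a))\<^sup>2 \<le> real q ^ n / real H ^ n *
           (\<Sum>h\<in>box n (real H). sqrt (real q ^ n * real (kernel_count n c q h)))"
proof -
  let ?V = "residue_vectors n q" and ?W = "residue_vectors n H"
  let ?f = "phase n c q a" and ?D = "correlation n c q a"
  define u where "u = (\<lambda>x. \<Sum>h\<in>?W. ?f (\<lambda>i. x i + h i))"
  have supp: "h i = 0" if "h \<in> ?W" "n \<le> i" for h i
    using that by (auto simp: residue_vectors_def)
  have "of_nat (H ^ n) * S n c q a = (\<Sum>h\<in>?W. \<Sum>x\<in>?V. ?f x)"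
    by (simp add: S_ez phase_def)
  also have "\<dots> = (\<Sum>h\<in>?W. \<Sum>x\<in>?V. ?f (\<lambda>i. x i + h i))"
    by (intro sum.cong refl sum_residue_vectors_shift[symmetric] q phase_cong supp)
  also have "\<dots> = (\<Sum>x\<in>?V. u x)"
    unfolding u_def by (rule sum.swap)
  finally have "real H ^ n * cmod (S n c q a) = cmod (\<Sum>x\<in>?V. u x)"
    by (metis norm_mult norm_of_nat of_nat_power)
  also have "\<dots> \<le> (\<Sum>x\<in>?V. cmod (u x))"
    by (rule norm_sum)
  finally have "(real H ^ n * cmod (S n c q a))\<^sup>2 \<le> (\<Sum>x\<in>?V. cmod (u x))\<^sup>2"
    by (intro power_mono) auto
  also have "\<dots> \<le> real q ^ n * (\<Sum>x\<in>?V. (cmod (u x))\<^sup>2)"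
    using sum_norm_squared_le[of ?V "\<lambda>x. cmod (u x)"] by simp
  also have "(\<Sum>x\<in>?V. (cmod (u x))\<^sup>2) \<le> real H ^ n * (\<Sum>d\<in>box n (real H). cmod (?D d))"
  proof -
    have "complex_of_real (\<Sum>x\<in>?V. (cmod (u x))\<^sup>2) = (\<Sum>x\<in>?V. u x * cnj (u x))"
      by (simp add: complex_norm_square[symmetric])
    also have "\<dots> = (\<Sum>x\<in>?V. \<Sum>h'\<in>?W. \<Sum>h\<in>?W. ?f (\<lambda>i. x i + h i) * cnj (?f (\<lambda>i. x i + h' i)))"
      by (simp add: u_def cnj_sum sum_distrib_left sum_distrib_right)
    also have "\<dots> = (\<Sum>h'\<in>?W. \<Sum>x\<in>?V. \<Sum>h\<in>?W. ?f (\<lambda>i. x i + h i) * cnj (?f (\<lambda>i. x i + h' i)))"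
      by (rule sum.swap)
    also have "\<dots> = (\<Sum>h'\<in>?W. \<Sum>h\<in>?W. \<Sum>x\<in>?V. ?f (\<lambda>i. x i + h i) * cnj (?f (\<lambda>i. x i + h' i)))"
      by (intro sum.cong refl sum.swap)
    also have "\<dots> = (\<Sum>h'\<in>?W. \<Sum>h\<in>?W. ?D (\<lambda>i. h i - h' i))"
      by (intro sum.cong refl correlation_shift q supp)
    finally have eq: "complex_of_real (\<Sum>x\<in>?V. (cmod (u x))\<^sup>2) = (\<Sum>h'\<in>?W. \<Sum>h\<in>?W. ?D (\<lambda>i. h i - h' i))" .
    have "(\<Sum>x\<in>?V. (cmod (u x))\<^sup>2) = cmod (complex_of_real (\<Sum>x\<in>?V. (cmod (u x))\<^sup>2))"
      unfolding norm_of_real by (simp add: sum_nonneg)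
    also have "\<dots> = cmod (\<Sum>h'\<in>?W. \<Sum>h\<in>?W. ?D (\<lambda>i. h i - h' i))"
      unfolding eq ..
    also have "\<dots> \<le> (\<Sum>h'\<in>?W. \<Sum>h\<in>?W. cmod (?D (\<lambda>i. h i - h' i)))"
      by (rule order_trans[OF norm_sum]) (intro sum_mono norm_sum)
    \<comment> \<open>For fixed \<open>h'\<close> each difference arises from at most one
      \<open>h\<close>, and nonnegative terms allow extension to the whole box. The remaining sum
      over \<open>h'\<close> gives one factor H^n, which cancels half of the H^(2n) from
      averaging.\<close>
    also have "\<dots> \<le> (\<Sum>h'\<in>?W. \<Sum>d\<in>box n (real H). cmod (?D d))"
    proof (rule sum_mono)
      fix h' assume h': "h' \<in> ?W"
      have "inj_on (\<lambda>h i. h i - h' i) ?W"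
        by (auto simp: inj_on_def fun_eq_iff)
      then have "(\<Sum>h\<in>?W. cmod (?D (\<lambda>i. h i - h' i)))
          = (\<Sum>d\<in>(\<lambda>h i. h i - h' i) ` ?W. cmod (?D d))"
        by (simp add: sum.reindex)
      also have "\<dots> \<le> (\<Sum>d\<in>box n (real H). cmod (?D d))"
      proof (rule sum_mono2)
        show "(\<lambda>h i. h i - h' i) ` ?W \<subseteq> box n (real H)"
        proof (clarsimp simp: box_def residue_vectors_def, intro conjI allI impI)
          fix h i assume "\<forall>i<n. 0 \<le> h i \<and> h i < int H" "i < n"
          then have "0 \<le> h i" "h i < int H" "0 \<le> h' i" "h' i < int H"
            using h' by (auto simp: residue_vectors_def)
          then show "\<bar>real_of_int (h i) - real_of_int (h' i)\<bar> \<le> real H" by linarith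
        qed (use h' in \<open>auto simp: residue_vectors_def\<close>)
      qed auto
      finally show "(\<Sum>h\<in>?W. cmod (?D (\<lambda>i. h i - h' i))) \<le> (\<Sum>d\<in>box n (real H). cmod (?D d))" .
    qed
    also have "\<dots> = real H ^ n * (\<Sum>d\<in>box n (real H). cmod (?D d))"
      by simp
    finally show ?thesis .
  qed
  also have "(\<Sum>d\<in>box n (real H). cmod (?D d))
      \<le> (\<Sum>h\<in>box n (real H). sqrt (real q ^ n * real (kernel_count n c q h)))"
    by (intro sum_mono real_le_rsqrt norm_correlation_le sym q a) (auto simp: box_def)
  finally have "(real H ^ n)\<^sup>2 * (cmod (S n c q a))\<^sup>2 \<le> real q ^ n * (real H ^ n *
      (\<Sum>h\<in>box n (real H). sqrt (real q ^ n * real (kernel_count n c q h))))"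
    by (simp add: power_mult_distrib mult_left_mono)
  then show ?thesis
    using H by (simp add: field_simps power2_eq_square)
qed

section \<open>Counting kernels of the matrices M(h)\<close>

lemma bij_betw_pick:
  assumes "finite J"
  shows "bij_betw (pick J) {..<card J} J"
proof (rule bij_betw_imageI)
  show "inj_on (pick J) {..<card J}"
    by (rule inj_onI) (metis card_pick lessThan_iff)
  show "pick J ` {..<card J} = J"
  proof
    show "pick J ` {..<card J} \<subseteq> J" using pick_in_set[of _ J] by auto
    show "J \<subseteq> pick J ` {..<card J}"
    proof
      fix k assume k: "k \<in> J"
      then have "card {a \<in> J. a < k} < card J"
        using assms by (intro psubset_card_mono) auto
      then show "k \<in> pick J ` {..<card J}"
        by (intro image_eqI[of _ _ "card {a \<in> J. a < k}"]) (simp_all add: pick_card_in_set[OF k])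
    qed
  qed
qed

text \<open>This is Cramer's rule. Because \<open>z\<close> is supported on \<open>J\<close>, the
  rows in \<open>I\<close> involve only the square minor, and multiplication by its adjugate leaves
  the determinant times \<open>z\<close>. No division occurs, so the argument survives modulo a
  composite \<open>m\<close>.\<close>

lemma minor_annihilates_kernel:
  fixes A :: "int mat"
  assumes A: "A \<in> carrier_mat n n" and I: "I \<subseteq> {..<n}" and J: "J \<subseteq> {..<n}"
    and card: "card I = card J"
    and z: "\<And>k. k \<notin> J \<Longrightarrow> z k = 0"
    and ker: "\<And>i. i < n \<Longrightarrow> m dvd (\<Sum>k<n. A $$ (i, k) * z k)"
    and k: "k \<in> J"
  shows "m dvd det (submatrix A I J) * z k"
proof -
  define r where "r = card J"
  define B where "B = submatrix A I J"
  define w where "w = vec r (\<lambda>t. z (pick J t))"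
  have eqs: "{i. i < dim_row A \<and> i \<in> I} = I" "{i. i < dim_col A \<and> i \<in> J} = J"
    using A I J by auto
  have fin: "finite I" "finite J" using I J finite_subset by auto
  have B: "B \<in> carrier_mat r r"
    unfolding B_def by (rule carrier_matI) (simp_all only: dim_submatrix eqs card r_def)
  have w: "w \<in> carrier_vec r" by (simp add: w_def)
  have Bw: "m dvd (B *\<^sub>v w) $ s" if s: "s < r" for s
  proof -
    have "(B *\<^sub>v w) $ s = (\<Sum>t<r. B $$ (s, t) * w $ t)"
      using s B w by (simp add: scalar_prod_def atLeast0LessThan)
    also have "\<dots> = (\<Sum>t<r. A $$ (pick I s, pick J t) * z (pick J t))"
    proof (rule sum.cong[OF refl])
      fix t assume "t \<in> {..<r}"
      then show "B $$ (s, t) * w $ t = A $$ (pick I s, pick J t) * z (pick J t)"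
        using s submatrix_index[of s A I t J] by (simp add: eqs B_def w_def r_def card)
    qed
    also have "\<dots> = (\<Sum>k\<in>J. A $$ (pick I s, k) * z k)"
      unfolding r_def by (rule sum.reindex_bij_betw[OF bij_betw_pick[OF fin(2)]])
    also have "\<dots> = (\<Sum>k<n. A $$ (pick I s, k) * z k)"
      using J z by (intro sum.mono_neutral_left) auto
    finally show ?thesis
      using ker[of "pick I s"] pick_in_set[of s I] s I by (auto simp: r_def card)
  qed
  have "k \<in> pick J ` {..<r}"
    using bij_betw_imp_surj_on[OF bij_betw_pick[OF fin(2)]] k by (simp add: r_def)
  then obtain s where s: "s < r" "pick J s = k" by auto
  have "(det B \<cdot>\<^sub>m 1\<^sub>m r) *\<^sub>v w = det B \<cdot>\<^sub>v w"
    using w by (intro eq_vecI) (auto simp: scalar_prod_def if_distrib[of "\<lambda>u. _ * u * _"] cong: if_cong)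
  then have "adj_mat B *\<^sub>v (B *\<^sub>v w) = det B \<cdot>\<^sub>v w"
    using adj_mat(3)[OF B] assoc_mult_mat_vec[OF adj_mat(1)[OF B] B w] by simp
  then have "det B * z k = (adj_mat B *\<^sub>v (B *\<^sub>v w)) $ s"
    using s w by (simp add: w_def)
  also have "\<dots> = (\<Sum>t<r. adj_mat B $$ (s, t) * (B *\<^sub>v w) $ t)"
    using s B adj_mat(1)[OF B] by (simp add: scalar_prod_def atLeast0LessThan)
  finally have "det (submatrix A I J) * z k = (\<Sum>t<r. adj_mat B $$ (s, t) * (B *\<^sub>v w) $ t)"
    unfolding B_def .
  moreover have "m dvd (\<Sum>t<r. adj_mat B $$ (s, t) * (B *\<^sub>v w) $ t)"
    by (intro dvd_sum dvd_mult Bw) simp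
  ultimately show ?thesis by simp
qed

lemma Mmat_carrier [simp]: "Mmat n c h \<in> carrier_mat n n"
  by (simp add: Mmat_def)

lemma Mvec_diff: "Mvec n c h (\<lambda>i. y i - y' i) j = Mvec n c h y j - Mvec n c h y' j"
  by (simp add: Mvec_def right_diff_distrib sum_subtractf)

lemma rank_mod_attained:
  assumes "p \<noteq> 1"
  obtains I J where "I \<subseteq> {..<n}" "J \<subseteq> {..<n}" "card I = rank_mod p n c h" "card J = rank_mod p n c h"
    "\<not> int p dvd det (submatrix (Mmat n c h) I J)"
proof -
  define K where "K = {k. \<exists>I J. I \<subseteq> {..<n} \<and> J \<subseteq> {..<n} \<and> card I = k \<and> card J = k \<and>
        \<not> (int p dvd det (submatrix (Mmat n c h) I J))}"
  have "K \<subseteq> {..n}"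
  proof
    fix k assume "k \<in> K"
    then obtain I where "I \<subseteq> {..<n}" "card I = k" unfolding K_def by blast
    then show "k \<in> {..n}" using card_mono[of "{..<n}" I] by simp
  qed
  then have "finite K" using finite_subset by blast
  \<comment> \<open>The empty minor has determinant 1, so the set under \<open>Max\<close> is
    nonempty; this is where p \<noteq> 1 enters.\<close>
  moreover have "det (submatrix (Mmat n c h) {} {}) = 1"
    by (rule det_dim_zero) (simp add: submatrix_def)
  then have "\<not> int p dvd det (submatrix (Mmat n c h) {} {})" using assms by simp
  then have "0 \<in> K"
    unfolding K_def mem_Collect_eq by (intro exI[of _ "{}"]) simp
  ultimately have "rank_mod p n c h \<in> K"
    unfolding rank_mod_def K_def[symmetric] by (intro Max_in) auto
  then obtain I J where "I \<subseteq> {..<n}" "J \<subseteq> {..<n}" "card I = rank_mod p n c h" "card J = rank_mod p n c h"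
    "\<not> int p dvd det (submatrix (Mmat n c h) I J)"
    unfolding K_def by blast
  then show ?thesis by (rule that)
qed

text \<open>A minor that is nonzero mod \<open>p\<close> is a unit mod p^k, and so is 6 because p >
  3. The coordinates of a solution outside the columns of the minor therefore determine the others
  modulo p^k.\<close>

lemma kernel_count_prime_power_le:
  assumes p: "prime p" "p > 3"
  shows "kernel_count n c (p ^ k) h \<le> (p ^ k) ^ (n - rank_mod p n c h)"
proof -
  obtain I J where IJ: "I \<subseteq> {..<n}" "J \<subseteq> {..<n}" "card I = rank_mod p n c h" "card J = rank_mod p n c h"
    and D: "\<not> int p dvd det (submatrix (Mmat n c h) I J)"
    using rank_mod_attained[of p n c h] p by auto
  let ?D = "det (submatrix (Mmat n c h) I J)"
  have pi: "prime (int p)" using p by simp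
  have "\<not> p dvd 6"
  proof
    assume "p dvd 6"
    then have "p dvd 2 * 3" by simp
    then have "p dvd 2 \<or> p dvd 3" using p prime_dvd_mult_iff by blast
    then show False using p by (auto dest: dvd_imp_le)
  qed
  then have "\<not> int p dvd 6" using int_dvd_int_iff[of p 6] by simp
  then have "\<not> int p dvd 6 * ?D" using D pi prime_dvd_mult_iff by blast
  then have "coprime (int p) (6 * ?D)" by (rule prime_imp_coprime[OF pi])
  then have cop: "coprime (int (p ^ k)) (6 * ?D)"
    unfolding of_nat_power by (intro coprime_power_left_iff[THEN iffD2] disjI1)
  have "kernel_count n c (p ^ k) h \<le> card {0..<int (p ^ k)} ^ (n - card J)"
    unfolding kernel_count_def
  proof (rule card_le_determined_coordinates[OF _ _ IJ(2)])
    fix y y' :: "nat \<Rightarrow> int"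
    assume y: "y \<in> {y \<in> residue_vectors n (p ^ k). \<forall>j<n. int (p ^ k) dvd 6 * Mvec n c h y j}"
      and y': "y' \<in> {y \<in> residue_vectors n (p ^ k). \<forall>j<n. int (p ^ k) dvd 6 * Mvec n c h y j}"
      and eq: "\<And>i. i \<notin> J \<Longrightarrow> y i = y' i"
    show "y = y'"
    proof
      fix i
      show "y i = y' i"
      proof (cases "i \<in> J")
        case True
        have "int (p ^ k) dvd ?D * (6 * (y i - y' i))"
        proof (rule minor_annihilates_kernel[OF Mmat_carrier IJ(1,2) _ _ _ True])
          fix j assume j: "j < n"
          have "(\<Sum>k<n. Mmat n c h $$ (j, k) * (6 * (y k - y' k))) = 6 * Mvec n c h y j - 6 * Mvec n c h y' j"
            by (simp add: Mvec_def algebra_simps sum_subtractf sum_distrib_left)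
          then show "int (p ^ k) dvd (\<Sum>k<n. Mmat n c h $$ (j, k) * (6 * (y k - y' k)))"
            using y y' j by (auto intro: dvd_diff)
        qed (use IJ eq in auto)
        then have "int (p ^ k) dvd (6 * ?D) * (y i - y' i)" by (simp only: mult_ac)
        then have "int (p ^ k) dvd y i - y' i" using cop by (simp add: coprime_dvd_mult_right_iff)
        moreover have "\<bar>y i - y' i\<bar> < int (p ^ k)"
        proof -
          have "i < n" using IJ(2) True by auto
          then have "0 \<le> y i" "y i < int (p ^ k)" "0 \<le> y' i" "y' i < int (p ^ k)"
            using y y' unfolding residue_vectors_def by blast+
          then show ?thesis by linarith
        qed
        ultimately show ?thesis
          using zdvd_imp_le[of "int (p ^ k)" "\<bar>y i - y' i\<bar>"] by auto
      qed (use eq in auto)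
    qed
  qed (auto simp: residue_vectors_fvec)
  also have "card {0..<int (p ^ k)} = p ^ k"
    by (simp only: card_atLeastLessThan_int diff_zero nat_int)
  finally show ?thesis by (simp only: IJ)
qed

section \<open>Rational rank and short kernel vectors\<close>

lemma rank_Q_independent_columns:
  obtains J where "J \<subseteq> {..<n}" "card J = rank_Q n c x"
    "\<And>z i. (\<And>k. k \<notin> J \<Longrightarrow> z k = 0) \<Longrightarrow> (\<And>j. j < n \<Longrightarrow> Mvec n c x z j = 0) \<Longrightarrow> z i = 0"
proof -
  interpret vec_space "TYPE(rat)" n .
  define A :: "rat mat" where "A = map_mat of_int (Mmat n c x)"
  have A: "A \<in> carrier_mat n n" by (simp add: A_def)
  have A_index: "A $$ (i, k) = of_int (Mmat n c x $$ (i, k))" if "i < n" "k < n" for i k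
    using that by (simp add: A_def Mmat_def)
  have "lin_indpt {}" by (rule finite_lin_indpt2) auto
  then obtain S where S: "maximal S (\<lambda>T. T \<subseteq> set (cols A) \<and> lin_indpt T)"
    using maximal_exists_superset[of "set (cols A)" "\<lambda>T. T \<subseteq> set (cols A) \<and> lin_indpt T" "{}"] by blast
  have S_cols: "S \<subseteq> set (cols A)" and indpt: "lin_indpt S"
    using S by (auto simp: maximal_def)
  have fin: "finite S" using S_cols finite_subset by blast
  \<comment> \<open>Equal columns coincide as members of \<open>S\<close>, whereas the coordinates
    of \<open>z\<close> are indexed by positions. One position is therefore chosen for each
    vector.\<close>
  have "\<forall>s\<in>S. \<exists>k<n. col A k = s"
  proof
    fix s assume "s \<in> S"
    then have "s \<in> col A ` {0..<n}" using S_cols A by (auto simp: cols_def)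
    then show "\<exists>k<n. col A k = s" by auto
  qed
  then obtain f where "\<forall>s\<in>S. f s < n \<and> col A (f s) = s"
    unfolding bchoice_iff by blast
  then have f: "\<And>s. s \<in> S \<Longrightarrow> f s < n" "\<And>s. s \<in> S \<Longrightarrow> col A (f s) = s"
    by auto
  have inj: "inj_on f S" by (rule inj_on_inverseI[of _ "col A"]) (rule f)
  have card: "card (f ` S) = rank_Q n c x"
    using rank_card_indpt[OF A S] card_image[OF inj] by (simp add: rank_Q_def A_def)
  have ker_trivial: "z i = 0"
    if supp: "\<And>k. k \<notin> f ` S \<Longrightarrow> z k = 0" and ker: "\<And>j. j < n \<Longrightarrow> Mvec n c x z j = 0" for z i
  proof (cases "i \<in> f ` S")
    case True
    then obtain s where s: "s \<in> S" "i = f s" by auto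
    \<comment> \<open>With these coefficients a kernel vector supported on the chosen positions is a
      linear relation among the independent columns, so it is trivial.\<close>
    define a :: "rat vec \<Rightarrow> rat" where "a = (\<lambda>s. of_int (z (f s)))"
    have Sc: "S \<subseteq> carrier_vec n" using S_cols cols_dim[of A] A by auto
    have "lincomb a S = 0\<^sub>v n"
    proof (rule eq_vecI)
      fix j assume "j < dim_vec (0\<^sub>v n :: rat vec)"
      then have j: "j < n" by simp
      have "lincomb a S $ j = (\<Sum>s\<in>S. a s * s $ j)"
        by (rule lincomb_index[OF j Sc])
      also have "\<dots> = (\<Sum>s\<in>S. of_int (Mmat n c x $$ (j, f s) * z (f s)))"
      proof (rule sum.cong[OF refl])
        fix s assume s: "s \<in> S"
        have "s $ j = A $$ (j, f s)"
          by (subst f(2)[OF s, symmetric]) (use f(1)[OF s] A j in simp)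
        then show "a s * s $ j = of_int (Mmat n c x $$ (j, f s) * z (f s))"
          using A_index[OF j f(1)[OF s]] by (simp add: a_def)
      qed
      also have "\<dots> = (\<Sum>k\<in>f ` S. of_int (Mmat n c x $$ (j, k) * z k))"
        by (simp add: sum.reindex[OF inj])
      also have "\<dots> = (\<Sum>k<n. of_int (Mmat n c x $$ (j, k) * z k))"
        using f(1) supp by (intro sum.mono_neutral_left) auto
      also have "\<dots> = of_int (Mvec n c x z j)"
        by (simp add: Mvec_def)
      finally show "lincomb a S $ j = 0\<^sub>v n $ j"
        using ker[OF j] j by simp
    qed (use lincomb_dim[OF fin Sc] in simp)
    then have "a s = 0"
      using lin_dep_crit[OF fin subset_refl _ s(1), of a] indpt by auto
    then show ?thesis by (simp add: a_def s)
  qed (use supp in auto)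
  show ?thesis
    by (rule that[of "f ` S"]) (use f(1) in \<open>auto intro: card ker_trivial\<close>)
qed

lemma rank_Q_le: "rank_Q n c x \<le> n"
  using vec_space.rank_le_nc[of "map_mat of_int (Mmat n c x)" n n] by (simp add: rank_Q_def)

text \<open>The defining congruences are linear, so subtracting one solution of a cell from all the
  others in that cell yields short solutions. There are T^n cells of side q/T.\<close>

lemma kernel_count_le_short_vectors:
  assumes T: "T > 0" and q: "q > 0"
  shows "kernel_count n c q h \<le> T ^ n * card {d \<in> fvec {..<n} {- int ((q - 1) div T)..int ((q - 1) div T)}.
           \<forall>j<n. int q dvd 6 * Mvec n c h d j}"
proof -
  define Y where "Y = {y \<in> residue_vectors n q. \<forall>j<n. int q dvd 6 * Mvec n c h y j}"
  define D where "D = {d \<in> fvec {..<n} {- int ((q - 1) div T)..int ((q - 1) div T)}.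
           \<forall>j<n. int q dvd 6 * Mvec n c h d j}"
  \<comment> \<open>f y is the cell of y when the cube of side q is cut into T^n cells.\<close>
  define f where "f = (\<lambda>(y :: nat \<Rightarrow> int) i. y i * int T div int q)"
  have finD: "finite D"
    by (rule finite_subset[OF _ finite_fvec]) (auto simp: D_def)
  have f_range: "f y \<in> residue_vectors n T" if "y \<in> Y" for y
  proof -
    have y: "\<And>i. n \<le> i \<Longrightarrow> y i = 0" "\<And>i. i < n \<Longrightarrow> 0 \<le> y i" "\<And>i. i < n \<Longrightarrow> y i < int q"
      using that by (auto simp: Y_def residue_vectors_def)
    have "0 \<le> f y i" "f y i < int T" if "i < n" for i
    proof -
      show "0 \<le> f y i" using y(2)[OF that] q by (simp add: f_def pos_imp_zdiv_nonneg_iff)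
      have "y i * int T < int T * int q" using y(3)[OF that] T by (simp add: mult.commute)
      moreover have "f y i * int q \<le> y i * int T"
        unfolding f_def using q div_mult_mod_eq[of "y i * int T" "int q"] pos_mod_sign[of "int q" "y i * int T"]
        by linarith
      ultimately have "f y i * int q < int T * int q" by linarith
      then show "f y i < int T" using q by (simp add: mult_less_cancel_right)
    qed
    then show ?thesis using y(1) by (auto simp: residue_vectors_def f_def)
  qed
  have fiber: "card {y \<in> Y. f y = t} \<le> card D" for t
  proof (cases "{y \<in> Y. f y = t} = {}")
    case False
    then obtain y0 where y0: "y0 \<in> Y" "f y0 = t" by auto
    have "(\<lambda>y i. y i - y0 i) ` {y \<in> Y. f y = t} \<subseteq> D"
    proof clarify
      fix y assume y: "y \<in> Y" "t = f y"
      have le: "\<bar>y i - y0 i\<bar> \<le> int ((q - 1) div T)" for i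
      proof -
        have "y i * int T div int q = y0 i * int T div int q"
          using y y0 by (simp add: f_def fun_eq_iff)
        \<comment> \<open>Equal quotients by \<open>q\<close> give a strict inequality between
          integers, hence at most q - 1; this is the origin of the radius
          \<open>(q - 1) div T\<close>.\<close>
        then have "\<bar>y i * int T - y0 i * int T\<bar> < int q"
          using q div_mult_mod_eq[of "y i * int T" "int q"] div_mult_mod_eq[of "y0 i * int T" "int q"]
            pos_mod_bound[of "int q" "y i * int T"] pos_mod_bound[of "int q" "y0 i * int T"]
            pos_mod_sign[of "int q" "y i * int T"] pos_mod_sign[of "int q" "y0 i * int T"]
          unfolding of_nat_0_less_iff abs_less_iff by smt
        then have "\<bar>y i - y0 i\<bar> * int T \<le> int (q - 1)"
          using T q by (simp add: left_diff_distrib[symmetric] abs_mult of_nat_diff)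
        then have "nat \<bar>y i - y0 i\<bar> * T \<le> q - 1"
          by (intro of_nat_le_iff[where 'a = int, THEN iffD1]) simp
        then have "nat \<bar>y i - y0 i\<bar> \<le> (q - 1) div T"
          using T by (simp add: less_eq_div_iff_mult_less_eq)
        then show ?thesis by linarith
      qed
      have "- int ((q - 1) div T) \<le> y i - y0 i" "y i - y0 i \<le> int ((q - 1) div T)" for i
        using le[of i] by linarith+
      then show "(\<lambda>i. y i - y0 i) \<in> D"
        using y y0 by (auto simp: D_def Y_def fvec_def residue_vectors_def Mvec_diff right_diff_distrib intro: dvd_diff)
    qed
    moreover have "inj_on (\<lambda>y i. y i - y0 i) {y \<in> Y. f y = t}"
      by (auto simp: inj_on_def fun_eq_iff)
    ultimately show ?thesis using finD by (intro card_inj_on_le)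
  qed (simp only: card.empty)
  have "Y = (\<Union>t\<in>residue_vectors n T. {y \<in> Y. f y = t})"
    using f_range by auto
  then have "card Y = card (\<Union>t\<in>residue_vectors n T. {y \<in> Y. f y = t})"
    by (rule arg_cong)
  also have "\<dots> \<le> (\<Sum>t\<in>residue_vectors n T. card {y \<in> Y. f y = t})"
    by (rule card_UN_le) simp
  also have "\<dots> \<le> (\<Sum>t\<in>residue_vectors n T. card D)"
    by (intro sum_mono fiber)
  finally show ?thesis
    by (simp add: Y_def D_def kernel_count_def)
qed

section \<open>The bound of order 5n/6 for complete sums\<close>

definition coeff_sum :: "nat \<Rightarrow> (nat \<Rightarrow> nat \<Rightarrow> nat \<Rightarrow> int) \<Rightarrow> nat" where
  "coeff_sum n c = nat (\<Sum>j<n. \<Sum>k<n. \<Sum>i<n. \<bar>c i j k\<bar>)"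

lemma abs_Mvec_le:
  assumes h: "\<And>i. i < n \<Longrightarrow> \<bar>h i\<bar> \<le> int H" and d: "\<And>i. i < n \<Longrightarrow> \<bar>d i\<bar> \<le> int w" and j: "j < n"
  shows "\<bar>Mvec n c h d j\<bar> \<le> int (coeff_sum n c * H * w)"
proof -
  have "\<bar>Mvec n c h d j\<bar> \<le> (\<Sum>k<n. \<bar>Mmat n c h $$ (j, k) * d k\<bar>)"
    unfolding Mvec_def by (rule sum_abs)
  also have "\<dots> \<le> (\<Sum>k<n. (\<Sum>i<n. \<bar>c i j k\<bar> * int H) * int w)"
  proof (rule sum_mono)
    fix k assume k: "k \<in> {..<n}"
    have "\<bar>Mmat n c h $$ (j, k)\<bar> \<le> (\<Sum>i<n. \<bar>c i j k * h i\<bar>)"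
      using j k by (simp add: Mmat_def)
    also have "\<dots> \<le> (\<Sum>i<n. \<bar>c i j k\<bar> * int H)"
      using h by (intro sum_mono) (auto simp: abs_mult intro!: mult_left_mono)
    finally show "\<bar>Mmat n c h $$ (j, k) * d k\<bar> \<le> (\<Sum>i<n. \<bar>c i j k\<bar> * int H) * int w"
      using d k by (auto simp: abs_mult intro!: mult_mono sum_nonneg)
  qed
  also have "\<dots> = (\<Sum>k<n. \<Sum>i<n. \<bar>c i j k\<bar>) * int H * int w"
    by (simp add: sum_distrib_right)
  also have "\<dots> \<le> (\<Sum>j<n. \<Sum>k<n. \<Sum>i<n. \<bar>c i j k\<bar>) * int H * int w"
    using j by (intro mult_right_mono member_le_sum[of j _ "\<lambda>j. \<Sum>k<n. \<Sum>i<n. \<bar>c i j k\<bar>"] sum_nonneg) auto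
  also have "\<dots> = int (coeff_sum n c * H * w)"
    by (simp add: coeff_sum_def sum_nonneg)
  finally show ?thesis .
qed

lemma box_abs_le:
  assumes "h \<in> box n (real H)" "i < n"
  shows "\<bar>h i\<bar> \<le> int H"
proof -
  have "real_of_int \<bar>h i\<bar> \<le> real_of_int (int H)"
    using assms by (simp add: box_def)
  then show ?thesis by (simp only: of_int_le_iff)
qed

text \<open>On short vectors the congruence modulo \<open>q\<close> is an equation over the
  integers, so the rational rank controls their number. The T^n cells supply H^n, of which H^(n-r)
  is absorbed by the side length of the box of short vectors.\<close>

lemma kernel_count_le_rank_Q:
  obtains K :: real where "K > 0"
    "\<And>q H h. 0 < q \<Longrightarrow> 0 < H \<Longrightarrow> H \<le> 2 * q \<Longrightarrow> h \<in> box n (real H) \<Longrightarrow>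
       real (kernel_count n c q h) \<le> K * real H ^ rank_Q n c h * real q ^ (n - rank_Q n c h)"
proof -
  \<comment> \<open>The 6 times \<open>coeff_sum\<close> makes all entries of 6 M(h) d smaller than
    \<open>q\<close> for short \<open>d\<close>. The added 1 keeps \<open>T\<close> positive when
    all coefficients vanish.\<close>
  define L where "L = 6 * coeff_sum n c + 1"
  have bound: "real (kernel_count n c q h) \<le> (4 * real L) ^ n * real H ^ rank_Q n c h * real q ^ (n - rank_Q n c h)"
    if q: "0 < q" and H: "0 < H" "H \<le> 2 * q" and h: "h \<in> box n (real H)" for q H h
  proof -
    define r where "r = rank_Q n c h"
    define T where "T = L * H"
    define w where "w = (q - 1) div T"
    define D where "D = {d \<in> fvec {..<n} {- int w..int w}. \<forall>j<n. int q dvd 6 * Mvec n c h d j}"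
    have L: "L \<ge> 1" by (simp add: L_def)
    have T: "T > 0" using H L by (simp add: T_def)
    have r: "r \<le> n" by (simp add: r_def rank_Q_le)
    have wT: "w * T \<le> q - 1" by (simp add: w_def)
    have ker: "Mvec n c h d j = 0" if "d \<in> D" "j < n" for d j
    proof -
      have "\<bar>d i\<bar> \<le> int w" if "i < n" for i
      proof -
        have "d i \<in> {- int w..int w}" using \<open>d \<in> D\<close> that unfolding D_def fvec_def by blast
        then show ?thesis by (auto simp: abs_le_iff)
      qed
      then have "\<bar>Mvec n c h d j\<bar> \<le> int (coeff_sum n c * H * w)"
        by (intro abs_Mvec_le box_abs_le[OF h] that(2))
      then have "\<bar>6 * Mvec n c h d j\<bar> \<le> int (6 * coeff_sum n c * H * w)" by simp
      also have "6 * coeff_sum n c * H * w \<le> w * T" by (simp add: T_def L_def algebra_simps)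
      also have "w * T < q" using wT q by simp
      finally have "\<bar>6 * Mvec n c h d j\<bar> < int q" by simp
      moreover have "int q dvd 6 * Mvec n c h d j" using that by (simp add: D_def)
      ultimately show ?thesis
        using zdvd_not_zless[of "\<bar>6 * Mvec n c h d j\<bar>" "int q"] by fastforce
    qed
    obtain J where J: "J \<subseteq> {..<n}" "card J = r"
      and inj: "\<And>z i. (\<And>k. k \<notin> J \<Longrightarrow> z k = 0) \<Longrightarrow> (\<And>j. j < n \<Longrightarrow> Mvec n c h z j = 0) \<Longrightarrow> z i = 0"
      using rank_Q_independent_columns[of n c h] unfolding r_def by blast
    have "card D \<le> card {- int w..int w} ^ (n - card J)"
    proof (rule card_le_determined_coordinates[OF _ _ J(1)])
      fix y y' assume y: "y \<in> D" "y' \<in> D" "\<And>i. i \<notin> J \<Longrightarrow> y i = y' i"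
      have "y i - y' i = 0" for i
        using inj[of "\<lambda>i. y i - y' i" i] y ker by (simp add: Mvec_diff)
      then show "y = y'" by (simp add: fun_eq_iff)
    qed (auto simp: D_def)
    also have "card {- int w..int w} = 2 * w + 1" by simp
    finally have "card D \<le> (2 * w + 1) ^ (n - r)" by (simp only: J)
    then have D_le: "real (card D) \<le> real (2 * w + 1) ^ (n - r)"
      unfolding of_nat_power[symmetric] of_nat_le_iff .
    have "real w * real T \<le> real q"
      using wT by (metis diff_le_self le_trans of_nat_le_iff of_nat_mult)
    moreover have "real w * real H \<le> real w * real T"
      using L unfolding of_nat_mult[symmetric] of_nat_le_iff T_def by simp
    ultimately have "real w * real H \<le> real q" by linarith
    \<comment> \<open>The summand \<open>real H\<close> coming from the 1 in 2w + 1 is at most 2q by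
      the assumption on \<open>H\<close>; this also covers w = 0.\<close>
    then have w_le: "real (2 * w + 1) * real H \<le> 4 * real q"
      using H by (simp add: algebra_simps)
    have "real (kernel_count n c q h) \<le> real (T ^ n * card D)"
      unfolding of_nat_le_iff D_def w_def by (rule kernel_count_le_short_vectors[OF T q])
    also have "\<dots> \<le> (real L * real H) ^ n * real (2 * w + 1) ^ (n - r)"
      using D_le by (simp add: T_def mult_left_mono)
    also have "\<dots> = real L ^ n * real H ^ r * (real (2 * w + 1) * real H) ^ (n - r)"
      using r by (simp add: power_mult_distrib flip: power_add)
    also have "\<dots> \<le> real L ^ n * real H ^ r * (4 * real q) ^ (n - r)"
      by (intro mult_left_mono power_mono w_le) auto
    also have "\<dots> = real L ^ n * 4 ^ (n - r) * real H ^ r * real q ^ (n - r)"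
      by (simp add: power_mult_distrib)
    also have "\<dots> \<le> real L ^ n * 4 ^ n * real H ^ r * real q ^ (n - r)"
      by (intro mult_right_mono mult_left_mono power_increasing) auto
    finally show ?thesis by (simp add: r_def power_mult_distrib mult_ac)
  qed
  show ?thesis
    by (rule that[of "(4 * real L) ^ n"]) (use bound in \<open>auto simp: L_def\<close>)
qed

lemma sum_group_by_rank:
  fixes f :: "'a \<Rightarrow> real" and g :: "'a \<Rightarrow> nat"
  assumes "finite A" "\<And>x. x \<in> A \<Longrightarrow> g x \<le> n"
    and "\<And>x. x \<in> A \<Longrightarrow> f x \<le> b (g x)"
  shows "sum f A \<le> (\<Sum>r\<le>n. real (card {x \<in> A. g x = r}) * b r)"
proof -
  have "sum f A = (\<Sum>r\<le>n. sum f {x \<in> A. g x = r})"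
    using assms by (intro sum.group[symmetric]) auto
  also have "\<dots> \<le> (\<Sum>r\<le>n. real (card {x \<in> A. g x = r}) * b r)"
    using assms by (intro sum_mono sum_bounded_above) auto
  finally show ?thesis .
qed

theorem complete_sum_bound:
  assumes sym: "symmetric_coeffs n c" and geom: "davenport_geometric n c" and eps: "\<epsilon> > 0"
  obtains K where "\<And>q a. 0 < q \<Longrightarrow> coprime a q \<Longrightarrow>
    (cmod (S n c q a))\<^sup>2 \<le> K * real q powr ((5 * real n + \<epsilon>) / 3)"
proof -
  obtain K1 where K1: "K1 > 0"
    and kc: "\<And>q H h. 0 < q \<Longrightarrow> 0 < H \<Longrightarrow> H \<le> 2 * q \<Longrightarrow> h \<in> box n (real H) \<Longrightarrow>
       real (kernel_count n c q h) \<le> K1 * real H ^ rank_Q n c h * real q ^ (n - rank_Q n c h)"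
    using kernel_count_le_rank_Q[of n c] by blast
  have "\<forall>r. \<exists>K. r \<le> n \<longrightarrow> (\<forall>P\<ge>1. real (card {x \<in> box n P. rank_Q n c x = r}) \<le> K * P powr (real r + \<epsilon>))"
    using geom eps unfolding davenport_geometric_def by blast
  then obtain G where G: "\<And>r P. r \<le> n \<Longrightarrow> P \<ge> 1 \<Longrightarrow>
      real (card {x \<in> box n P. rank_Q n c x = r}) \<le> G r * P powr (real r + \<epsilon>)"
    by metis
  \<comment> \<open>Both powers of 2 come from rounding: \<open>H\<close> is at most 2s rather than
    \<open>s\<close>, once in the count of the h and once in the kernel bound.\<close>
  define B where "B = (\<lambda>r. \<bar>G r\<bar> * 2 powr (real r + \<epsilon>) * sqrt (K1 * 2 ^ r))"
  have "(cmod (S n c q a))\<^sup>2 \<le> (\<Sum>r\<le>n. B r) * real q powr ((5 * real n + \<epsilon>) / 3)"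
    if q: "0 < q" and a: "coprime a q" for q a
  proof -
    \<comment> \<open>Every quantity is measured in powers of the real cube root \<open>s\<close> of
      \<open>q\<close>; in these units q^n H^r q^(n-r) is (s^(3n-r))^2 up to a constant.\<close>
    define s where "s = real q powr (1 / 3)"
    define H where "H = nat \<lceil>s\<rceil>"
    have s: "s \<ge> 1" using q by (simp add: s_def ge_one_powr_ge_zero)
    have s3: "real q = s ^ 3"
      using q by (simp add: s_def powr_power)
    have H: "s \<le> real H" "real H \<le> 2 * s" "H > 0"
      using s by (simp_all add: H_def) linarith+
    have "s * 1 \<le> s * s ^ 2" using s by (intro mult_left_mono) auto
    then have "s \<le> real q" by (simp add: s3 power_numeral_reduce)
    then have Hq: "H \<le> 2 * q" using H by linarith
    have term_le: "sqrt (real q ^ n * real (kernel_count n c q h))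
        \<le> sqrt (K1 * 2 ^ rank_Q n c h) * s ^ (3 * n - rank_Q n c h)" if h: "h \<in> box n (real H)" for h
    proof -
      define r where "r = rank_Q n c h"
      have r: "r \<le> n" by (simp add: r_def rank_Q_le)
      have "real q ^ n * real (kernel_count n c q h) \<le> real q ^ n * (K1 * real H ^ r * real q ^ (n - r))"
        using kc[OF q H(3) Hq h] by (simp add: r_def mult_left_mono)
      also have "\<dots> \<le> real q ^ n * (K1 * (2 * s) ^ r * real q ^ (n - r))"
        using H K1 by (intro mult_left_mono mult_right_mono power_mono) auto
      also have "\<dots> = K1 * 2 ^ r * (s ^ (3 * n) * s ^ r * s ^ (3 * (n - r)))"
        by (simp add: s3 power_mult_distrib power_mult[symmetric] mult_ac)
      also have "s ^ (3 * n) * s ^ r * s ^ (3 * (n - r)) = (s ^ (3 * n - r))\<^sup>2"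
        using r by (simp flip: power_add power_mult) (simp add: algebra_simps)
      finally have "sqrt (real q ^ n * real (kernel_count n c q h)) \<le> sqrt (K1 * 2 ^ r * (s ^ (3 * n - r))\<^sup>2)"
        by (rule real_sqrt_le_mono)
      then show ?thesis using s by (simp add: real_sqrt_mult r_def)
    qed
    have "(\<Sum>h\<in>box n (real H). sqrt (real q ^ n * real (kernel_count n c q h)))
        \<le> (\<Sum>r\<le>n. real (card {h \<in> box n (real H). rank_Q n c h = r}) * (sqrt (K1 * 2 ^ r) * s ^ (3 * n - r)))"
      by (rule sum_group_by_rank) (auto simp: rank_Q_le intro: term_le)
    also have "\<dots> \<le> (\<Sum>r\<le>n. B r * (s ^ (3 * n) * s powr \<epsilon>))"
    proof (rule sum_mono)
      fix r assume r: "r \<in> {..n}"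
      have "real (card {h \<in> box n (real H). rank_Q n c h = r}) \<le> G r * real H powr (real r + \<epsilon>)"
        using r H by (intro G) auto
      also have "\<dots> \<le> \<bar>G r\<bar> * (2 * s) powr (real r + \<epsilon>)"
        using H eps s by (intro mult_mono powr_mono2) auto
      also have "\<dots> = \<bar>G r\<bar> * 2 powr (real r + \<epsilon>) * s ^ r * s powr \<epsilon>"
        using s by (simp add: powr_mult powr_add powr_realpow)
      finally have "real (card {h \<in> box n (real H). rank_Q n c h = r}) * (sqrt (K1 * 2 ^ r) * s ^ (3 * n - r))
          \<le> \<bar>G r\<bar> * 2 powr (real r + \<epsilon>) * s ^ r * s powr \<epsilon> * (sqrt (K1 * 2 ^ r) * s ^ (3 * n - r))"
        using K1 s by (intro mult_right_mono) auto
      also have "\<dots> = B r * ((s ^ r * s ^ (3 * n - r)) * s powr \<epsilon>)"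
        by (simp add: B_def mult_ac)
      \<comment> \<open>The number of h of rank \<open>r\<close> and the size of their terms
        compensate each other, which expresses the choice of H.\<close>
      also have "s ^ r * s ^ (3 * n - r) = s ^ (3 * n)"
        using r by (simp flip: power_add)
      finally show "real (card {h \<in> box n (real H). rank_Q n c h = r}) * (sqrt (K1 * 2 ^ r) * s ^ (3 * n - r))
          \<le> B r * (s ^ (3 * n) * s powr \<epsilon>)" .
    qed
    also have "\<dots> = (\<Sum>r\<le>n. B r) * (s ^ (3 * n) * s powr \<epsilon>)"
      by (simp add: sum_distrib_right)
    finally have sum_le: "(\<Sum>h\<in>box n (real H). sqrt (real q ^ n * real (kernel_count n c q h)))
        \<le> (\<Sum>r\<le>n. B r) * (s ^ (3 * n) * s powr \<epsilon>)" .
    have "real q ^ n / real H ^ n \<le> s ^ (3 * n) / s ^ n"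
      using H s by (intro frac_le power_mono) (auto simp: s3 power_mult)
    also have "\<dots> = s ^ (2 * n)"
      using s by (simp add: power_diff[symmetric])
    finally have factor: "real q ^ n / real H ^ n \<le> s ^ (2 * n)" .
    have "(cmod (S n c q a))\<^sup>2 \<le> real q ^ n / real H ^ n *
        (\<Sum>h\<in>box n (real H). sqrt (real q ^ n * real (kernel_count n c q h)))"
      by (rule van_der_Corput_Weyl[OF sym q a H(3)])
    also have "\<dots> \<le> s ^ (2 * n) * ((\<Sum>r\<le>n. B r) * (s ^ (3 * n) * s powr \<epsilon>))"
      using s by (intro mult_mono factor sum_le sum_nonneg) auto
    also have "\<dots> = (\<Sum>r\<le>n. B r) * (s ^ (2 * n + 3 * n) * s powr \<epsilon>)"
      by (simp only: power_add mult_ac)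
    also have "s ^ (2 * n + 3 * n) * s powr \<epsilon> = s powr (5 * real n + \<epsilon>)"
      using s by (simp add: powr_add powr_realpow[symmetric])
    also have "\<dots> = real q powr ((5 * real n + \<epsilon>) / 3)"
      by (simp add: s_def powr_powr)
    finally show ?thesis .
  qed
  then show ?thesis by (rule that)
qed

section \<open>Multiplicativity and the Euler product\<close>

lemma cubic_form_combination_cong:
  "[cubic_form n c (\<lambda>i. u * x i + v * y i) = u ^ 3 * cubic_form n c x + v ^ 3 * cubic_form n c y] (mod u * v)"
proof -
  let ?T = "trilinear n c"
  have "cubic_form n c (\<lambda>i. u * x i + v * y i) - (u ^ 3 * cubic_form n c x + v ^ 3 * cubic_form n c y)
    = u * v * (u * (?T x x y + ?T x y x + ?T y x x) + v * (?T x y y + ?T y x y + ?T y y x))"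
    unfolding cubic_form_trilinear trilinear_add trilinear_scale
    by (simp add: algebra_simps power3_eq_cube)
  then show ?thesis
    by (simp add: cong_iff_dvd_diff)
qed

lemma cong_cancel_coprime_residues:
  fixes q q' x y x' y' :: int
  assumes "coprime q q'" "0 \<le> x" "x < q" "0 \<le> x'" "x' < q"
    and "(q' * x + q * y) mod (q * q') = (q' * x' + q * y') mod (q * q')"
  shows "x = x'"
proof -
  have "[q' * x + q * y = q' * x' + q * y'] (mod q)"
    using assms(6) unfolding cong_def[symmetric] by (rule cong_modulus_mult)
  then have "[q' * x = q' * x'] (mod q)"
    by (simp add: cong_def)
  then have "[x = x'] (mod q)"
    using assms(1) by (simp add: cong_mult_lcancel coprime_commute)
  then show ?thesis
    using assms by (simp add: cong_def)
qed

lemma bij_betw_residue_vectors_combination: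
  assumes cop: "coprime q q'" and pos: "q > 0" "q' > 0"
  shows "bij_betw (\<lambda>(x, y) i. (int q' * x i + int q * y i) mod int (q * q'))
    (residue_vectors n q \<times> residue_vectors n q') (residue_vectors n (q * q'))"
    (is "bij_betw ?f ?A ?B")
proof -
  have inj: "inj_on ?f ?A"
  proof (rule inj_onI, clarify)
    fix x y x' y' assume xy: "x \<in> residue_vectors n q" "y \<in> residue_vectors n q'"
      "x' \<in> residue_vectors n q" "y' \<in> residue_vectors n q'"
      and eq: "(\<lambda>i. (int q' * x i + int q * y i) mod int (q * q')) = (\<lambda>i. (int q' * x' i + int q * y' i) mod int (q * q'))"
    have cop': "coprime (int q) (int q')" "coprime (int q') (int q)"
      using cop by (simp_all add: coprime_commute)
    have e: "(int q' * x i + int q * y i) mod (int q * int q') = (int q' * x' i + int q * y' i) mod (int q * int q')" for i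
      using fun_cong[OF eq, of i] by simp
    have "x i = x' i \<and> y i = y' i" for i
    proof (cases "i < n")
      case True
      then have r: "0 \<le> x i" "x i < int q" "0 \<le> x' i" "x' i < int q"
          "0 \<le> y i" "y i < int q'" "0 \<le> y' i" "y' i < int q'"
        using xy by (auto simp: residue_vectors_def)
      have "x i = x' i"
        using cong_cancel_coprime_residues[OF cop'(1) r(1-4) e] .
      moreover have "y i = y' i"
        using cong_cancel_coprime_residues[OF cop'(2) r(5-8), of "x i" "x' i"] e[of i]
        by (simp add: add.commute mult.commute)
      ultimately show ?thesis by simp
    next
      case False
      then show ?thesis using xy by (auto simp: residue_vectors_def)
    qed
    then show "x = x' \<and> y = y'" by auto
  qed
  moreover have "?f ` ?A \<subseteq> ?B"
    using pos by (auto simp: residue_vectors_def)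
  then have "?f ` ?A = ?B"
    using card_image[OF inj]
    by (intro card_subset_eq) (simp_all only: card_cartesian_product card_residue_vectors finite_residue_vectors power_mult_distrib)
  ultimately show ?thesis by (simp add: bij_betw_def)
qed

text \<open>The Chinese remainder theorem represents residues mod q q' as q'x + qy, and the mixed
  terms of the cubic vanish there. The twists of \<open>a\<close> come from q'^3/(q q') = q'^2/q and
  its mirror image.\<close>

lemma S_mult:
  assumes cop: "coprime q q'" and pos: "q > 0" "q' > 0"
  shows "S n c (q * q') a = S n c q (a * q' ^ 2) * S n c q' (a * q ^ 2)"
proof -
  let ?A = "residue_vectors n q" and ?B = "residue_vectors n q'"
  have term_eq: "ez (q * q') (int a * cubic_form n c (\<lambda>i. (int q' * x i + int q * y i) mod int (q * q')))
      = ez q (int (a * q' ^ 2) * cubic_form n c x) * ez q' (int (a * q ^ 2) * cubic_form n c y)" for x y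
  proof -
    have qq: "q * q' > 0" using pos by simp
    have "[cubic_form n c (\<lambda>i. (int q' * x i + int q * y i) mod int (q * q'))
        = cubic_form n c (\<lambda>i. int q' * x i + int q * y i)] (mod int (q * q'))"
      unfolding cubic_form_trilinear by (intro cong_trilinear) (simp_all add: cong_def)
    also have "[cubic_form n c (\<lambda>i. int q' * x i + int q * y i)
        = int q' ^ 3 * cubic_form n c x + int q ^ 3 * cubic_form n c y] (mod int (q * q'))"
      using cubic_form_combination_cong[of n c "int q'" x "int q" y] by (simp add: mult.commute)
    finally have "ez (q * q') (int a * cubic_form n c (\<lambda>i. (int q' * x i + int q * y i) mod int (q * q')))
        = ez (q * q') (int a * (int q' ^ 3 * cubic_form n c x + int q ^ 3 * cubic_form n c y))"
      by (intro ez_cong qq cong_mult cong_refl)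
    also have "\<dots> = ez (q * q') (int a * int q' ^ 3 * cubic_form n c x) * ez (q * q') (int a * int q ^ 3 * cubic_form n c y)"
      by (simp add: ez_add[symmetric] algebra_simps)
    also have "ez (q * q') (int a * int q' ^ 3 * cubic_form n c x) = ez q (int (a * q' ^ 2) * cubic_form n c x)"
      using pos by (simp add: ez_def power3_eq_cube power2_eq_square mult_ac)
    also have "ez (q * q') (int a * int q ^ 3 * cubic_form n c y) = ez q' (int (a * q ^ 2) * cubic_form n c y)"
      using pos by (simp add: ez_def power3_eq_cube power2_eq_square mult_ac)
    finally show ?thesis .
  qed
  have "S n c (q * q') a = (\<Sum>(x, y)\<in>?A \<times> ?B.
      ez (q * q') (int a * cubic_form n c (\<lambda>i. (int q' * x i + int q * y i) mod int (q * q'))))"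
    unfolding S_ez
    by (subst sum.reindex_bij_betw[OF bij_betw_residue_vectors_combination[OF assms], symmetric])
       (simp add: case_prod_unfold)
  also have "\<dots> = (\<Sum>(x, y)\<in>?A \<times> ?B. ez q (int (a * q' ^ 2) * cubic_form n c x) * ez q' (int (a * q ^ 2) * cubic_form n c y))"
    unfolding term_eq ..
  also have "\<dots> = S n c q (a * q' ^ 2) * S n c q' (a * q ^ 2)"
    unfolding S_ez sum_product sum.cartesian_product ..
  finally show ?thesis .
qed

section \<open>Maxima over a and the Euler product\<close>

lemma norm_S_le: "cmod (S n c q a) \<le> real q ^ n"
proof -
  have "cmod (S n c q a) \<le> (\<Sum>x\<in>residue_vectors n q. 1)"
    unfolding S_ez by (rule order_trans[OF norm_sum]) simp
  then show ?thesis by simp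
qed

text \<open>Here \<open>a\<close> runs over all naturals coprime to \<open>q\<close>, not over
  residues, so the twisted arguments of \<open>S_mult\<close> qualify without reduction. The trivial
  bound q^n keeps the supremum finite.\<close>

definition max_S :: "nat \<Rightarrow> (nat \<Rightarrow> nat \<Rightarrow> nat \<Rightarrow> int) \<Rightarrow> nat \<Rightarrow> real" where
  "max_S n c q = (SUP a\<in>{a. coprime a q}. cmod (S n c q a))"

lemma norm_S_le_max_S: "coprime a q \<Longrightarrow> cmod (S n c q a) \<le> max_S n c q"
  unfolding max_S_def by (rule cSUP_upper) (auto intro!: bdd_aboveI2 norm_S_le)

lemma max_S_le: "(\<And>a. coprime a q \<Longrightarrow> cmod (S n c q a) \<le> B) \<Longrightarrow> max_S n c q \<le> B"
  unfolding max_S_def by (rule cSUP_least) (auto intro!: exI[of _ 1])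

lemma max_S_nonneg: "0 \<le> max_S n c q"
  by (rule order_trans[OF norm_ge_zero norm_S_le_max_S[of 1]]) simp

lemma max_S_mult_le:
  assumes cop: "coprime q q'" and pos: "q > 0" "q' > 0"
  shows "max_S n c (q * q') \<le> max_S n c q * max_S n c q'"
proof (rule max_S_le)
  fix a assume "coprime a (q * q')"
  then have a: "coprime (a * q' ^ 2) q" "coprime (a * q ^ 2) q'"
    using cop by (auto simp: coprime_commute)
  show "cmod (S n c (q * q') a) \<le> max_S n c q * max_S n c q'"
    unfolding S_mult[OF assms] norm_mult
    by (intro mult_mono norm_S_le_max_S a max_S_nonneg) auto
qed

text \<open>This is the F of the overview; the factor \<open>q\<close> accounts for the number of
  residues \<open>a\<close>.\<close>

definition series_majorant :: "nat \<Rightarrow> (nat \<Rightarrow> nat \<Rightarrow> nat \<Rightarrow> int) \<Rightarrow> nat \<Rightarrow> real" where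
  "series_majorant n c q = real q * max_S n c q / real q ^ n"

lemma series_majorant_nonneg: "0 \<le> series_majorant n c q"
  by (simp add: series_majorant_def max_S_nonneg)

lemma series_majorant_mult_le:
  assumes "coprime q q'" "q > 0" "q' > 0"
  shows "series_majorant n c (q * q') \<le> series_majorant n c q * series_majorant n c q'"
proof -
  have "real q * real q' / (real q ^ n * real q' ^ n) * max_S n c (q * q')
      \<le> real q * real q' / (real q ^ n * real q' ^ n) * (max_S n c q * max_S n c q')"
    by (intro mult_left_mono max_S_mult_le assms) auto
  then show ?thesis
    by (simp add: series_majorant_def power_mult_distrib mult_ac)
qed

lemma series_majorant_1_le: "series_majorant n c 1 \<le> 1"
proof -
  have "max_S n c 1 \<le> 1"
    using norm_S_le[of n c 1] by (intro max_S_le) simp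
  then show ?thesis by (simp add: series_majorant_def)
qed

text \<open>Induction on \<open>P\<close>, writing each member of \<open>X\<close> as a power of the
  new prime times a cofactor coprime to it. Finitely many primes and bounded exponents keep both
  sides finite, and F 1 \<le> 1 bounds the factor for exponent 0.\<close>

lemma sum_le_euler_product:
  fixes F :: "nat \<Rightarrow> real"
  assumes nonneg: "\<And>q. 0 \<le> F q" and F1: "F 1 \<le> 1"
    and mult: "\<And>q q'. coprime q q' \<Longrightarrow> q > 0 \<Longrightarrow> q' > 0 \<Longrightarrow> F (q * q') \<le> F q * F q'"
    and P: "finite P" "\<And>p. p \<in> P \<Longrightarrow> prime p"
    and X: "finite X" "\<And>q. q \<in> X \<Longrightarrow> q > 0 \<and> prime_factors q \<subseteq> P \<and> (\<forall>p. prime p \<longrightarrow> multiplicity p q \<le> m)"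
  shows "sum F X \<le> (\<Prod>p\<in>P. 1 + (\<Sum>k=1..m. F (p ^ k)))"
  using P X
proof (induction P arbitrary: X rule: finite_induct)
  case empty
  have "X \<subseteq> {1}"
  proof
    fix q assume "q \<in> X"
    then have "q > 0" "prime_factors q = {}" using empty(3) by auto
    then show "q \<in> {1}" using prime_factorization_empty_iff[of q] by auto
  qed
  then have "sum F X \<le> sum F {1}" using nonneg by (intro sum_mono2) auto
  then show ?case using F1 by simp
next
  case (insert p P)
  have p: "prime p" using insert.prems by auto
  define v where "v = multiplicity p"
  define g where "g = (\<lambda>q. q div p ^ v q)"
  have split: "q = p ^ v q * g q" for q
    unfolding g_def v_def using multiplicity_dvd[of p q] by simp
  have g_pos: "g q > 0" if "q \<in> X" for q
    using insert.prems(3)[OF that] split[of q] by (intro gr0I) auto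
  have cop: "coprime p (g q)" if "q \<in> X" for q
  proof -
    have "\<not> p dvd g q"
      using multiplicity_decompose[of q p] insert.prems(3)[OF that] prime_gt_1_nat[OF p]
      unfolding g_def v_def by auto
    then show ?thesis using p prime_imp_coprime by blast
  qed
  have "sum F (g ` X) \<le> (\<Prod>p\<in>P. 1 + (\<Sum>k=1..m. F (p ^ k)))"
  proof (rule insert.IH)
    fix q' assume "q' \<in> g ` X"
    then obtain q where q: "q \<in> X" "q' = g q" by auto
    have "g q dvd q" by (subst (2) split) simp
    have q0: "q \<noteq> 0" using insert.prems(3)[OF q(1)] by auto
    have "prime_factors q' \<subseteq> prime_factors q"
      unfolding q(2) using q0 \<open>g q dvd q\<close> by (rule dvd_prime_factors)
    moreover have "p \<notin> prime_factors q'"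
      using cop[OF q(1)] p unfolding q(2) by (auto simp: in_prime_factors_iff coprime_absorb_left)
    moreover have "multiplicity r q' \<le> m" if "prime r" for r
    proof -
      have "multiplicity r (g q) \<le> multiplicity r q"
        using \<open>g q dvd q\<close> q0 by (rule dvd_imp_multiplicity_le)
      then show ?thesis using insert.prems(3)[OF q(1)] that unfolding q(2) by (meson order_trans)
    qed
    ultimately show "q' > 0 \<and> prime_factors q' \<subseteq> P \<and> (\<forall>p. prime p \<longrightarrow> multiplicity p q' \<le> m)"
      using insert.prems(3)[OF q(1)] g_pos[OF q(1)] q(2) by blast
  qed (use insert.prems in auto)
  then have IH: "sum F (g ` X) \<le> (\<Prod>p\<in>P. 1 + (\<Sum>k=1..m. F (p ^ k)))" .
  have inj: "inj_on (\<lambda>q. (v q, g q)) X"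
  proof (rule inj_onI)
    fix q q' assume "(v q, g q) = (v q', g q')"
    then show "q = q'" using split[of q] split[of q'] by simp
  qed
  have "sum F X \<le> (\<Sum>q\<in>X. F (p ^ v q) * F (g q))"
  proof (rule sum_mono)
    fix q assume q: "q \<in> X"
    have "F (p ^ v q * g q) \<le> F (p ^ v q) * F (g q)"
      using cop[OF q] g_pos[OF q] p by (intro mult) (auto simp: prime_gt_0_nat)
    then show "F q \<le> F (p ^ v q) * F (g q)" using split[of q] by simp
  qed
  also have "\<dots> = (\<Sum>(k, q')\<in>(\<lambda>q. (v q, g q)) ` X. F (p ^ k) * F q')"
    by (simp add: sum.reindex[OF inj])
  \<comment> \<open>The pairs that occur are completed to a full rectangle, over which the sum
    factors.\<close>
  also have "\<dots> \<le> (\<Sum>(k, q')\<in>{0..m} \<times> g ` X. F (p ^ k) * F q')"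
    using insert.prems p nonneg by (intro sum_mono2) (auto simp: v_def)
  also have "\<dots> = (\<Sum>k=0..m. F (p ^ k)) * sum F (g ` X)"
    by (simp add: sum_product sum.cartesian_product)
  also have "\<dots> \<le> (1 + (\<Sum>k=1..m. F (p ^ k))) * (\<Prod>p\<in>P. 1 + (\<Sum>k=1..m. F (p ^ k)))"
  proof (rule mult_mono[OF _ IH])
    show "(\<Sum>k=0..m. F (p ^ k)) \<le> 1 + (\<Sum>k=1..m. F (p ^ k))"
      using F1 by (simp add: sum.atLeast_Suc_atMost)
  qed (use nonneg in \<open>auto intro!: sum_nonneg add_nonneg_nonneg\<close>)
  also have "\<dots> = (\<Prod>p\<in>insert p P. 1 + (\<Sum>k=1..m. F (p ^ k)))"
    using insert.hyps by simp
  finally show ?case .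
qed

text \<open>Since 1 + t \<le> exp t, a bound \<open>B\<close> for the double sum uniform in
  \<open>P\<close> and \<open>m\<close> bounds every finite Euler product by exp B. The index 0 has
  no factorization, so \<open>F 0\<close> is added separately.\<close>

lemma summable_submultiplicative:
  fixes F :: "nat \<Rightarrow> real"
  assumes nonneg: "\<And>q. 0 \<le> F q" and F1: "F 1 \<le> 1"
    and mult: "\<And>q q'. coprime q q' \<Longrightarrow> q > 0 \<Longrightarrow> q' > 0 \<Longrightarrow> F (q * q') \<le> F q * F q'"
    and bound: "\<And>P m. finite P \<Longrightarrow> (\<And>p. p \<in> P \<Longrightarrow> prime p) \<Longrightarrow> (\<Sum>p\<in>P. \<Sum>k=1..m. F (p ^ k)) \<le> B"
  shows "summable F"
proof (rule summableI_nonneg_bounded[OF nonneg, where x = "F 0 + exp B"])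
  fix N :: nat
  define P where "P = {p. prime p \<and> p < N}"
  have finP: "finite P" by (rule finite_subset[of _ "{..<N}"]) (auto simp: P_def)
  have "sum F {1..<N} \<le> (\<Prod>p\<in>P. 1 + (\<Sum>k=1..N. F (p ^ k)))"
  proof (rule sum_le_euler_product[OF nonneg F1 mult finP])
    fix q assume q: "q \<in> {1..<N}"
    have "prime_factors q \<subseteq> P"
      using q by (auto simp: P_def in_prime_factors_iff dest!: dvd_imp_le)
    moreover have "multiplicity p q \<le> N" if "prime p" for p
    proof -
      \<comment> \<open>Each exponent v satisfies v < p^v <= q < N, so cutting the exponents off at
        \<open>N\<close> loses nothing.\<close>
      have "multiplicity p q < p ^ multiplicity p q"
        using prime_gt_1_nat[OF that] by (intro power_gt_expt) simp
      also have "\<dots> \<le> q" using q by (intro dvd_imp_le multiplicity_dvd) auto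
      finally show ?thesis using q by simp
    qed
    ultimately show "q > 0 \<and> prime_factors q \<subseteq> P \<and> (\<forall>p. prime p \<longrightarrow> multiplicity p q \<le> N)"
      using q by auto
  qed (auto simp: P_def)
  also have "\<dots> \<le> (\<Prod>p\<in>P. exp (\<Sum>k=1..N. F (p ^ k)))"
    by (intro prod_mono conjI exp_ge_add_one_self add_nonneg_nonneg sum_nonneg nonneg) auto
  also have "\<dots> = exp (\<Sum>p\<in>P. \<Sum>k=1..N. F (p ^ k))"
    by (simp add: exp_sum finP)
  also have "\<dots> \<le> exp B"
    using bound[OF finP] by (simp add: P_def)
  finally have "sum F {1..<N} \<le> exp B" .
  moreover have "sum F {..<N} \<le> sum F (insert 0 {1..<N})"
    using nonneg by (intro sum_mono2) auto
  ultimately show "sum F {..<N} \<le> F 0 + exp B" by simp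
qed

section \<open>Moduli p and p^2 on average over dyadic ranges\<close>

lemma rank_mod_le:
  assumes "p \<noteq> 1"
  shows "rank_mod p n c h \<le> n"
proof -
  obtain I J where "I \<subseteq> {..<n}" "J \<subseteq> {..<n}" "card I = rank_mod p n c h" "card J = rank_mod p n c h"
    "\<not> int p dvd det (submatrix (Mmat n c h) I J)"
    by (rule rank_mod_attained[OF assms])
  then show ?thesis using card_mono[of "{..<n}" I] by simp
qed

text \<open>The averaged hypothesis controls |S(p^k,a)|^2 in the mean over \<open>p\<close>, and an
  arithmetic-geometric inequality converts this into the first moment. The assumption k \<le> 2
  makes full rank the worst case.\<close>

lemma dyadic_prime_power_bound:
  fixes \<epsilon> :: real
  assumes sym: "symmetric_coeffs n c" and n: "n > 0" and eps: "\<epsilon> > 0" and k: "1 \<le> k" "k \<le> 2"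
    and hyp: "\<And>r. r \<le> n \<Longrightarrow> \<exists>K. \<forall>H R. 1 \<le> H \<and> H \<le> R \<longrightarrow>
        real (card {(h, p). h \<in> box n H \<and> prime p \<and> R < real p \<and> real p \<le> 2 * R \<and>
                            rank_mod p n c h \<le> r})
          \<le> K * H ^ r * R powr (1 + \<epsilon>)"
  obtains K where "K \<ge> 0" "\<And>R :: nat. 3 \<le> R \<Longrightarrow>
    (\<Sum>p | prime p \<and> R < p \<and> p \<le> 2 * R. series_majorant n c (p ^ k))
      \<le> K * real R powr (real k * (1 - real n / 4) + (1 + \<epsilon>))"
proof -
  have "\<forall>r. \<exists>K. r \<le> n \<longrightarrow> (\<forall>H R. 1 \<le> H \<and> H \<le> R \<longrightarrow>
        real (card {(h, p). h \<in> box n H \<and> prime p \<and> R < real p \<and> real p \<le> 2 * R \<and>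
                            rank_mod p n c h \<le> r})
          \<le> K * H ^ r * R powr (1 + \<epsilon>))"
    using hyp by blast
  from choice[OF this] obtain G where "\<forall>r. r \<le> n \<longrightarrow> (\<forall>H R. 1 \<le> H \<and> H \<le> R \<longrightarrow>
        real (card {(h, p). h \<in> box n H \<and> prime p \<and> R < real p \<and> real p \<le> 2 * R \<and>
                            rank_mod p n c h \<le> r})
          \<le> G r * H ^ r * R powr (1 + \<epsilon>))"
    by (rule exE)
  then have G: "r \<le> n \<Longrightarrow> 1 \<le> H \<Longrightarrow> H \<le> R \<Longrightarrow>
      real (card {(h, p). h \<in> box n H \<and> prime p \<and> R < real p \<and> real p \<le> 2 * R \<and>
                            rank_mod p n c h \<le> r})
          \<le> G r * H ^ r * R powr (1 + \<epsilon>)" for r H R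
    by blast
  define C where "C = 2 ^ (2 * k * n) * (\<Sum>r\<le>n. \<bar>G r\<bar>)"
  have C: "C \<ge> 0" by (simp add: C_def sum_nonneg)
  have "(\<Sum>p | prime p \<and> R < p \<and> p \<le> 2 * R. series_majorant n c (p ^ k))
      \<le> (C + 1) * real R powr (real k * (1 - real n / 4) + (1 + \<epsilon>))"
    if R: "3 \<le> R" for R :: nat
  proof -
    define Pr where "Pr = {p. prime p \<and> R < p \<and> p \<le> 2 * R}"
    have finP: "finite Pr" by (rule finite_subset[of _ "{..2 * R}"]) (auto simp: Pr_def)
    \<comment> \<open>The differencing bound with H = R for q = p^k has a factor q^n outside and q^n
      q^(-r/2) inside the sum over h. Replacing \<open>p\<close> by 2R in the positive powers and by
      R in the negative one gives this expression, free of \<open>a\<close>.\<close>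
    define W where "W = (\<lambda>p. (2 * real R) ^ (2 * k * n) / real R ^ n *
        (\<Sum>h\<in>box n (real R). real R powr (- (real k * real (rank_mod p n c h) / 2))))"
    \<comment> \<open>The size of S(p^k, a) in mean square over p, up to R^\<epsilon>, which balances 2 |S| \<tau> <= |S|^2 + \<tau>^2.\<close>
    define \<tau> where "\<tau> = real R powr (3 / 4 * real k * real n)"
    have \<tau>: "\<tau> > 0" using R by (simp add: \<tau>_def)
    have W_nonneg: "W p \<ge> 0" for p by (simp add: W_def sum_nonneg)
    have S_le: "(cmod (S n c (p ^ k) a))\<^sup>2 \<le> W p" if p: "p \<in> Pr" and a: "coprime a (p ^ k)" for p a
    proof -
      have p': "prime p" "R < p" "p \<le> 2 * R" using p by (auto simp: Pr_def)
      have term_le: "sqrt (real (p ^ k) ^ n * real (kernel_count n c (p ^ k) h))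
          \<le> (2 * real R) ^ (k * n) * real R powr (- (real k * real (rank_mod p n c h) / 2))" for h
      proof -
        define r where "r = rank_mod p n c h"
        have r: "r \<le> n" unfolding r_def using p' by (intro rank_mod_le) auto
        \<comment> \<open>R \<ge> 3 ensures p > 3, so that 6 is invertible modulo p^k.\<close>
        have "real (kernel_count n c (p ^ k) h) \<le> real ((p ^ k) ^ (n - r))"
          unfolding of_nat_le_iff r_def using p' R by (intro kernel_count_prime_power_le) auto
        then have "real (p ^ k) ^ n * real (kernel_count n c (p ^ k) h) \<le> real (p ^ k) ^ n * real (p ^ k) ^ (n - r)"
          by (intro mult_left_mono) auto
        also have "\<dots> = (real p ^ (k * n))\<^sup>2 / real p ^ (k * r)"
        proof -
          have "real p ^ (k * (n - r)) * real p ^ (k * r) = real p ^ (k * n)"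
            using r by (simp only: power_add[symmetric] distrib_left[symmetric] le_add_diff_inverse2)
          then have "real p ^ (k * n) * real p ^ (k * (n - r)) * real p ^ (k * r) = (real p ^ (k * n))\<^sup>2"
            by (simp only: mult.assoc power2_eq_square)
          moreover have "real p ^ (k * r) \<noteq> 0" using p' by auto
          ultimately show ?thesis
            unfolding of_nat_power power_mult[symmetric] by (intro eq_divide_imp)
        qed
        also have "\<dots> \<le> ((2 * real R) ^ (k * n))\<^sup>2 / real R ^ (k * r)"
          using p' R by (intro frac_le power_mono) auto
        also have "\<dots> = ((2 * real R) ^ (k * n) * real R powr (- (real k * real r / 2)))\<^sup>2"
        proof -
          have "(real R powr (- (real k * real r / 2)))\<^sup>2 = real R powr (- real (k * r))"
            unfolding power2_eq_square powr_add[symmetric] by (rule arg_cong[of _ _ "(powr) (real R)"]) simp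
          also have "\<dots> = 1 / real R ^ (k * r)"
            using R by (simp add: powr_minus_divide powr_realpow del: of_nat_mult)
          finally show ?thesis by (simp add: power_mult_distrib)
        qed
        finally show ?thesis
          unfolding r_def by (rule real_le_lsqrt[rotated]) simp
      qed
      have "(cmod (S n c (p ^ k) a))\<^sup>2 \<le> real (p ^ k) ^ n / real R ^ n *
          (\<Sum>h\<in>box n (real R). sqrt (real (p ^ k) ^ n * real (kernel_count n c (p ^ k) h)))"
        using p' R by (intro van_der_Corput_Weyl[OF sym _ a]) auto
      also have "\<dots> \<le> (2 * real R) ^ (k * n) / real R ^ n *
          (\<Sum>h\<in>box n (real R). (2 * real R) ^ (k * n) * real R powr (- (real k * real (rank_mod p n c h) / 2)))"
      proof (rule mult_mono)
        have "real (p ^ k) ^ n \<le> (2 * real R) ^ (k * n)"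
          using p' unfolding of_nat_power power_mult[symmetric] by (intro power_mono) auto
        then show "real (p ^ k) ^ n / real R ^ n \<le> (2 * real R) ^ (k * n) / real R ^ n"
          by (rule divide_right_mono) simp
        show "(\<Sum>h\<in>box n (real R). sqrt (real (p ^ k) ^ n * real (kernel_count n c (p ^ k) h)))
          \<le> (\<Sum>h\<in>box n (real R). (2 * real R) ^ (k * n) * real R powr (- (real k * real (rank_mod p n c h) / 2)))"
          by (rule sum_mono) (rule term_le)
      qed (auto intro: sum_nonneg)
      also have "\<dots> = W p"
      proof -
        have "(2 * real R) ^ (k * n) * (2 * real R) ^ (k * n) = (2 * real R) ^ (2 * k * n)"
          unfolding power_add[symmetric] by (rule arg_cong[of _ _ "(^) (2 * real R)"]) simp
        then show ?thesis
          unfolding W_def sum_distrib_left[symmetric] by (simp only: mult.assoc[symmetric] times_divide_eq_left)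
      qed
      finally show ?thesis .
    qed
    have major_le: "series_majorant n c (p ^ k) \<le> real R powr (real k * (1 - real n)) * (W p / \<tau> + \<tau>)"
      if p: "p \<in> Pr" for p
    proof -
      have p': "prime p" "R < p" using p by (auto simp: Pr_def)
      have "max_S n c (p ^ k) \<le> W p / \<tau> + \<tau>"
      proof (rule max_S_le)
        fix a assume "coprime a (p ^ k)"
        then have le: "(cmod (S n c (p ^ k) a))\<^sup>2 \<le> W p" by (rule S_le[OF p])
        have "0 \<le> (cmod (S n c (p ^ k) a) - \<tau>)\<^sup>2" by simp
        then have "2 * cmod (S n c (p ^ k) a) * \<tau> \<le> (cmod (S n c (p ^ k) a))\<^sup>2 + \<tau>\<^sup>2"
          by (simp add: power2_diff)
        then have "cmod (S n c (p ^ k) a) * \<tau> \<le> W p + \<tau>\<^sup>2"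
          using le \<tau> mult_nonneg_nonneg[of "cmod (S n c (p ^ k) a)" \<tau>, OF norm_ge_zero] by linarith
        then show "cmod (S n c (p ^ k) a) \<le> W p / \<tau> + \<tau>"
          using \<tau> by (simp add: field_simps power2_eq_square)
      qed
      moreover have "real (p ^ k) / real (p ^ k) ^ n \<le> real R powr (real k * (1 - real n))"
      proof -
        have p0: "real p > 0" using p' by (simp add: prime_gt_0_nat)
        have "real (p ^ k) / real (p ^ k) ^ n = real p powr (real k) / real p powr (real k * real n)"
          unfolding of_nat_mult[symmetric] powr_realpow[OF p0] of_nat_power power_mult ..
        also have "\<dots> = real p powr (real k * (1 - real n))"
          by (simp add: powr_diff[symmetric] algebra_simps)
        also have "\<dots> \<le> real R powr (real k * (1 - real n))"
        proof (rule powr_mono2')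
          show "real k * (1 - real n) \<le> 0" using n by (simp add: mult_nonneg_nonpos)
        qed (use p' R in auto)
        finally show ?thesis .
      qed
      ultimately have "real (p ^ k) / real (p ^ k) ^ n * max_S n c (p ^ k)
          \<le> real R powr (real k * (1 - real n)) * (W p / \<tau> + \<tau>)"
        by (intro mult_mono max_S_nonneg) auto
      then show ?thesis by (simp add: series_majorant_def)
    qed
    have sum_W: "(\<Sum>p\<in>Pr. W p) \<le> C * real R powr (3 / 2 * real k * real n + (1 + \<epsilon>))"
    proof -
      define Z where "Z = box n (real R) \<times> Pr"
      define b where "b = (\<lambda>r. real R powr (- (real k * real r / 2)))"
      have "(\<Sum>p\<in>Pr. \<Sum>h\<in>box n (real R). real R powr (- (real k * real (rank_mod p n c h) / 2)))
          = (\<Sum>(h, p)\<in>Z. b (rank_mod p n c h))"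
        unfolding b_def Z_def sum.cartesian_product[symmetric] by (rule sum.swap)
      also have "\<dots> \<le> (\<Sum>r\<le>n. real (card {x \<in> Z. (case x of (h, p) \<Rightarrow> rank_mod p n c h) = r}) * b r)"
        using finP by (intro sum_group_by_rank) (auto simp: Z_def Pr_def intro!: rank_mod_le)
      also have "\<dots> \<le> (\<Sum>r\<le>n. \<bar>G r\<bar> * real R powr (real n - real k * real n / 2 + (1 + \<epsilon>)))"
      proof (rule sum_mono)
        fix r assume r: "r \<in> {..n}"
        have "real (card {x \<in> Z. (case x of (h, p) \<Rightarrow> rank_mod p n c h) = r})
            \<le> real (card {(h, p). h \<in> box n (real R) \<and> prime p \<and> real R < real p \<and> real p \<le> 2 * real R \<and>
                            rank_mod p n c h \<le> r})"
          unfolding of_nat_le_iff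
        proof (rule card_mono)
          show "finite {(h, p). h \<in> box n (real R) \<and> prime p \<and> real R < real p \<and> real p \<le> 2 * real R \<and>
                            rank_mod p n c h \<le> r}"
            by (rule finite_subset[of _ "box n (real R) \<times> {..2 * R}"]) auto
        qed (auto simp: Z_def Pr_def)
        also have "\<dots> \<le> G r * real R ^ r * real R powr (1 + \<epsilon>)"
          using r R by (intro G) auto
        also have "\<dots> \<le> \<bar>G r\<bar> * real R ^ r * real R powr (1 + \<epsilon>)"
          by (intro mult_right_mono) auto
        finally have "real (card {x \<in> Z. (case x of (h, p) \<Rightarrow> rank_mod p n c h) = r}) * b r
            \<le> \<bar>G r\<bar> * real R ^ r * real R powr (1 + \<epsilon>) * b r"
          by (intro mult_right_mono) (auto simp: b_def)
        also have "\<dots> = \<bar>G r\<bar> * real R powr (real r * (1 - real k / 2) + (1 + \<epsilon>))"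
        proof -
          have "real R ^ r * real R powr (1 + \<epsilon>) * b r
              = real R powr (real r + (1 + \<epsilon>) + - (real k * real r / 2))"
            using R by (simp only: b_def powr_add powr_realpow)
          also have "real r + (1 + \<epsilon>) + - (real k * real r / 2) = real r * (1 - real k / 2) + (1 + \<epsilon>)"
            by (simp add: algebra_simps)
          finally show ?thesis by (simp only: mult.assoc)
        qed
        also have "\<dots> \<le> \<bar>G r\<bar> * real R powr (real n - real k * real n / 2 + (1 + \<epsilon>))"
        proof (intro mult_left_mono powr_mono)
          \<comment> \<open>Here k \<le> 2 enters: the coefficient of \<open>r\<close> is
            nonnegative, so the exponent is largest at r = n.\<close>
          have "real r * (1 - real k / 2) \<le> real n * (1 - real k / 2)"
            using r k by (intro mult_right_mono) auto
          then show "real r * (1 - real k / 2) + (1 + \<epsilon>) \<le> real n - real k * real n / 2 + (1 + \<epsilon>)"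
            by (simp add: algebra_simps)
        qed (use R in auto)
        finally show "real (card {x \<in> Z. (case x of (h, p) \<Rightarrow> rank_mod p n c h) = r}) * b r
            \<le> \<bar>G r\<bar> * real R powr (real n - real k * real n / 2 + (1 + \<epsilon>))" .
      qed
      finally have main: "(\<Sum>p\<in>Pr. \<Sum>h\<in>box n (real R). real R powr (- (real k * real (rank_mod p n c h) / 2)))
          \<le> (\<Sum>r\<le>n. \<bar>G r\<bar>) * real R powr (real n - real k * real n / 2 + (1 + \<epsilon>))"
        by (simp add: sum_distrib_right)
      have "(\<Sum>p\<in>Pr. W p) = (2 * real R) ^ (2 * k * n) / real R ^ n *
          (\<Sum>p\<in>Pr. \<Sum>h\<in>box n (real R). real R powr (- (real k * real (rank_mod p n c h) / 2)))"
        by (simp add: W_def sum_distrib_left)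
      also have "\<dots> \<le> (2 * real R) ^ (2 * k * n) / real R ^ n *
          ((\<Sum>r\<le>n. \<bar>G r\<bar>) * real R powr (real n - real k * real n / 2 + (1 + \<epsilon>)))"
        by (intro mult_left_mono main) auto
      also have "\<dots> = C * (real R ^ (2 * k * n) / real R ^ n * real R powr (real n - real k * real n / 2 + (1 + \<epsilon>)))"
        by (simp add: C_def power_mult_distrib)
      also have "real R ^ (2 * k * n) / real R ^ n * real R powr (real n - real k * real n / 2 + (1 + \<epsilon>))
          = real R powr (real (2 * k * n) - real n + (real n - real k * real n / 2 + (1 + \<epsilon>)))"
        using R by (simp only: powr_add powr_diff powr_realpow[symmetric, where x = "real R"])
      also have "real (2 * k * n) - real n + (real n - real k * real n / 2 + (1 + \<epsilon>)) = 3 / 2 * real k * real n + (1 + \<epsilon>)"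
        by simp
      finally show ?thesis .
    qed
    \<comment> \<open>The trivial count suffices, as the sum of \<open>W\<close> already carries a
      factor R^(1+\<epsilon>).\<close>
    have card_Pr: "real (card Pr) \<le> real R"
    proof -
      have "card Pr \<le> card {R<..2 * R}" by (intro card_mono) (auto simp: Pr_def)
      then show ?thesis by simp
    qed
    define M where "M = (1 + \<epsilon>)"
    have "(\<Sum>p\<in>Pr. series_majorant n c (p ^ k))
        \<le> (\<Sum>p\<in>Pr. real R powr (real k * (1 - real n)) * (W p / \<tau> + \<tau>))"
      by (intro sum_mono major_le)
    also have "\<dots> = real R powr (real k * (1 - real n)) * ((\<Sum>p\<in>Pr. W p) / \<tau> + real (card Pr) * \<tau>)"
      by (simp add: sum_distrib_left[symmetric] sum.distrib sum_divide_distrib)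
    also have "\<dots> \<le> real R powr (real k * (1 - real n)) *
        (C * real R powr (3 / 2 * real k * real n + M) / \<tau> + real R powr M * \<tau>)"
    proof (intro mult_left_mono add_mono divide_right_mono mult_right_mono)
      show "(\<Sum>p\<in>Pr. W p) \<le> C * real R powr (3 / 2 * real k * real n + M)"
        by (rule order_trans[OF sum_W]) (use C R in \<open>auto intro!: mult_left_mono powr_mono simp: M_def\<close>)
      have "real R powr 1 \<le> real R powr M" using R by (intro powr_mono) (use eps in \<open>auto simp: M_def\<close>)
      then show "real (card Pr) \<le> real R powr M" using card_Pr R by simp
    qed (use \<tau> in auto)
    also have "\<dots> = real R powr (real k * (1 - real n)) *
        (C * (real R powr (3 / 2 * real k * real n + M) / \<tau>) + real R powr M * \<tau>)"
      by simp
    also have "real R powr (3 / 2 * real k * real n + M) / \<tau> = real R powr (3 / 4 * real k * real n + M)"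
      unfolding \<tau>_def powr_diff[symmetric] by (rule arg_cong[of _ _ "(powr) (real R)"]) simp
    also have "real R powr M * \<tau> = real R powr (3 / 4 * real k * real n + M)"
      unfolding \<tau>_def powr_add[symmetric] by (rule arg_cong[of _ _ "(powr) (real R)"]) simp
    also have "real R powr (real k * (1 - real n)) *
        (C * real R powr (3 / 4 * real k * real n + M) + real R powr (3 / 4 * real k * real n + M))
      = (C + 1) * real R powr (real k * (1 - real n) + (3 / 4 * real k * real n + M))"
    proof -
      have "A * (C * X + X) = (C + 1) * (A * X)" for A X :: real by (simp add: algebra_simps)
      then show ?thesis by (simp only: powr_add[of _ "real k * (1 - real n)"])
    qed
    also have "real k * (1 - real n) + (3 / 4 * real k * real n + M) = real k * (1 - real n / 4) + M"
      by (simp add: algebra_simps)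
    finally show ?thesis unfolding Pr_def M_def .
  qed
  then show ?thesis using C by (intro that[of "C + 1"]) auto
qed

section \<open>Convergence of the singular series\<close>

text \<open>The blocks form a geometric series. They begin at 2^2, the first power of 2 that is at
  least 3, as \<open>dyadic_prime_power_bound\<close> demands; the members up to 4 form a fixed
  finite sum.\<close>

lemma dyadic_sum_bounded:
  fixes f :: "nat \<Rightarrow> real"
  assumes nonneg: "\<And>p. 0 \<le> f p" and K: "K \<ge> 0" and x: "0 \<le> x" "x < 1"
    and dyadic: "\<And>j. 2 \<le> j \<Longrightarrow> (\<Sum>p | p \<in> A \<and> 2 ^ j < p \<and> p \<le> 2 * 2 ^ j. f p) \<le> K * x ^ j"
  obtains B where "\<And>P. finite P \<Longrightarrow> P \<subseteq> A \<Longrightarrow> sum f P \<le> B"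
proof
  fix P assume P: "finite P" "P \<subseteq> A"
  define B where "B = sum f {p \<in> A. p \<le> 4}"
  have partial: "sum f {p \<in> A. p \<le> 2 ^ (M + 2)} \<le> B + K * (\<Sum>j<M. x ^ j)" for M
  proof (induction M)
    case 0
    show ?case by (simp add: B_def)
  next
    case (Suc M)
    have "{p \<in> A. p \<le> 2 ^ (Suc M + 2)} = {p \<in> A. p \<le> 2 ^ (M + 2)} \<union> {p. p \<in> A \<and> 2 ^ (M + 2) < p \<and> p \<le> 2 * 2 ^ (M + 2)}"
      by auto
    then have "sum f {p \<in> A. p \<le> 2 ^ (Suc M + 2)}
        = sum f {p \<in> A. p \<le> 2 ^ (M + 2)} + (\<Sum>p | p \<in> A \<and> 2 ^ (M + 2) < p \<and> p \<le> 2 * 2 ^ (M + 2). f p)"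
      by (simp only:) (rule sum.union_disjoint, auto)
    also have "\<dots> \<le> (B + K * (\<Sum>j<M. x ^ j)) + K * x ^ (M + 2)"
      by (intro add_mono Suc.IH dyadic) simp
    also have "K * x ^ (M + 2) \<le> K * x ^ M"
      using K x by (intro mult_left_mono power_decreasing) auto
    finally show ?case by (simp add: distrib_left)
  qed
  obtain M where M: "\<And>p. p \<in> P \<Longrightarrow> p \<le> M"
    using P(1) by (auto simp: finite_nat_set_iff_bounded_le)
  \<comment> \<open>An upper bound for the set can itself serve as the number of blocks.\<close>
  have "M \<le> 2 ^ (M + 2)"
    using power_gt_expt[of 2 "M + 2"] by linarith
  then have "P \<subseteq> {p \<in> A. p \<le> 2 ^ (M + 2)}"
    using M P(2) by (auto intro: order_trans)
  then have "sum f P \<le> sum f {p \<in> A. p \<le> 2 ^ (M + 2)}"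
    using nonneg by (intro sum_mono2) auto
  also have "\<dots> \<le> B + K * (\<Sum>j<M. x ^ j)" by (rule partial)
  also have "(\<Sum>j<M. x ^ j) \<le> 1 / (1 - x)"
    using x by (simp add: sum_gp_strict divide_right_mono)
  finally show "sum f P \<le> sum f {p \<in> A. p \<le> 4} + K * (1 / (1 - x))"
    using K by (simp add: B_def mult_left_mono)
qed

text \<open>Exponents below -1/3 make the cubes of primes summable, and every exponent above -1/2 is
  available; -2/5 lies between. It arises from \<epsilon> = 3/5, as (45 + 3/5)/6 = 38/5 and 1 + 38/5
  - 9 = -2/5.\<close>

lemma series_majorant_decay:
  assumes sym: "symmetric_coeffs 9 c" and geom: "davenport_geometric 9 c"
  obtains C where "C \<ge> 0" "\<And>q. q > 0 \<Longrightarrow> series_majorant 9 c q \<le> C * real q powr (- 2 / 5)"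
proof -
  obtain K where K: "\<And>q a. 0 < q \<Longrightarrow> coprime a q \<Longrightarrow>
      (cmod (S 9 c q a))\<^sup>2 \<le> K * real q powr ((5 * real 9 + 3 / 5) / 3)"
    using complete_sum_bound[OF sym geom, of "3 / 5"] by auto
  have "series_majorant 9 c q \<le> sqrt \<bar>K\<bar> * real q powr (- 2 / 5)" if q: "q > 0" for q
  proof -
    have "max_S 9 c q \<le> sqrt \<bar>K\<bar> * real q powr (38 / 5)"
    proof (rule max_S_le)
      fix a assume a: "coprime a q"
      have "(cmod (S 9 c q a))\<^sup>2 \<le> \<bar>K\<bar> * real q powr ((5 * real 9 + 3 / 5) / 3)"
        by (rule order_trans[OF K[OF q a]]) (intro mult_right_mono, auto)
      also have "real q powr ((5 * real 9 + 3 / 5) / 3) = (real q powr (38 / 5))\<^sup>2"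
        by (simp add: power2_eq_square flip: powr_add)
      finally have "(cmod (S 9 c q a))\<^sup>2 \<le> (sqrt \<bar>K\<bar> * real q powr (38 / 5))\<^sup>2"
        by (simp add: power_mult_distrib)
      then show "cmod (S 9 c q a) \<le> sqrt \<bar>K\<bar> * real q powr (38 / 5)"
        by (rule power2_le_imp_le) simp
    qed
    then have "series_majorant 9 c q \<le> real q * (sqrt \<bar>K\<bar> * real q powr (38 / 5)) / real q ^ 9"
      unfolding series_majorant_def by (intro divide_right_mono mult_left_mono) auto
    also have "\<dots> = sqrt \<bar>K\<bar> * (real q powr 1 * real q powr (38 / 5) / real q powr real 9)"
      using q by (subst powr_realpow) simp_all
    also have "real q powr 1 * real q powr (38 / 5) / real q powr real 9 = real q powr (- 2 / 5)"
      unfolding powr_add[symmetric] powr_diff[symmetric] by simp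
    finally show ?thesis .
  qed
  then show ?thesis by (intro that[of "sqrt \<bar>K\<bar>"]) auto
qed

text \<open>The geometric series in \<open>k\<close> has the size of its first term p^(-6/5), which
  is summable over all positive integers and hence over the primes.\<close>

lemma sum_higher_prime_powers_bounded:
  fixes F :: "nat \<Rightarrow> real"
  assumes C: "C \<ge> 0" and F: "\<And>q. q > 0 \<Longrightarrow> F q \<le> C * real q powr (- 2 / 5)"
  obtains B where "\<And>P m. finite P \<Longrightarrow> (\<And>p. p \<in> P \<Longrightarrow> prime p) \<Longrightarrow> (\<Sum>p\<in>P. \<Sum>k=3..m. F (p ^ k)) \<le> B"
proof
  fix P :: "nat set" and m
  assume P: "finite P" "\<And>p. p \<in> P \<Longrightarrow> prime p"
  \<comment> \<open>The ratio at p = 2 is the largest, so 1/(1 - y0) bounds the geometric factor for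
    every prime.\<close>
  define y0 :: real where "y0 = 2 powr (- 2 / 5)"
  have y0: "y0 < 1" unfolding y0_def by (rule powr_less_one) auto
  have "(\<Sum>k=3..m. F (p ^ k)) \<le> C / (1 - y0) * real p powr (- 6 / 5)" if "p \<in> P" for p
  proof -
    have p: "p \<ge> 2" using P(2)[OF that] by (rule prime_ge_2_nat)
    define y where "y = real p powr (- 2 / 5)"
    have y: "y > 0" "y \<le> y0"
      using p by (auto simp: y_def y0_def intro!: powr_mono2')
    have "(\<Sum>k=3..m. F (p ^ k)) \<le> (\<Sum>k=3..m. C * y ^ k)"
    proof (rule sum_mono)
      fix k
      have "F (p ^ k) \<le> C * real (p ^ k) powr (- 2 / 5)" using p by (intro F) auto
      also have "real (p ^ k) powr (- 2 / 5) = y ^ k"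
        unfolding y_def using p by (simp add: powr_realpow[symmetric] powr_powr mult.commute)
      finally show "F (p ^ k) \<le> C * y ^ k" .
    qed
    also have "\<dots> = C * (\<Sum>k=3..m. y ^ k)" by (simp add: sum_distrib_left)
    also have "(\<Sum>k=3..m. y ^ k) \<le> y ^ 3 / (1 - y0)"
    proof (cases "3 \<le> m")
      case True
      have "(1 - y) * (\<Sum>k=3..m. y ^ k) \<le> y ^ 3"
        using sum_gp_multiplied[OF True, of y] y by simp
      moreover have "(1 - y0) * (\<Sum>k=3..m. y ^ k) \<le> (1 - y) * (\<Sum>k=3..m. y ^ k)"
        using y by (intro mult_right_mono sum_nonneg) auto
      ultimately show ?thesis using y0 by (simp add: field_simps)
    next
      case False
      then show ?thesis using y y0 by simp
    qed
    also have "y ^ 3 = real p powr (- 6 / 5)"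
      unfolding y_def using p by (simp add: powr_power)
    finally show ?thesis using C by (simp add: mult_left_mono)
  qed
  then have "(\<Sum>p\<in>P. \<Sum>k=3..m. F (p ^ k)) \<le> (\<Sum>p\<in>P. C / (1 - y0) * real p powr (- 6 / 5))"
    by (intro sum_mono)
  also have "\<dots> = C / (1 - y0) * (\<Sum>p\<in>P. real p powr (- 6 / 5))"
    by (simp add: sum_distrib_left)
  also have "\<dots> \<le> C / (1 - y0) * (\<Sum>q. real q powr (- 6 / 5))"
    using C y0 P(1) by (intro mult_left_mono sum_le_suminf) (auto simp: summable_real_powr_iff)
  finally show "(\<Sum>p\<in>P. \<Sum>k=3..m. F (p ^ k)) \<le> C / (1 - 2 powr (- 2 / 5)) * (\<Sum>q. real q powr (- 6 / 5))"
    by (simp add: y0_def)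
qed

theorem theorem2:
  fixes c :: "nat \<Rightarrow> nat \<Rightarrow> nat \<Rightarrow> int"
  assumes sym: "symmetric_coeffs 9 c"
    and geom: "davenport_geometric 9 c"
    and hyp: "\<forall>r\<le>9. \<forall>\<epsilon>>0. \<exists>K. \<forall>H R. 1 \<le> H \<and> H \<le> R \<longrightarrow>
        real (card {(h, p). h \<in> box 9 H \<and> prime p \<and> R < real p \<and> real p \<le> 2 * R \<and>
                            rank_mod p 9 c h \<le> r})
          \<le> K * H ^ r * R powr (1 + \<epsilon>)"
  shows "summable (\<lambda>q::nat. \<Sum>a \<in> {a \<in> {1..q}. coprime a q}. cmod (S 9 c q a) / real q ^ 9)"
proof -
  let ?F = "series_majorant 9 c"
  have low: "\<exists>B. \<forall>P. finite P \<longrightarrow> P \<subseteq> {p. prime p} \<longrightarrow> (\<Sum>p\<in>P. ?F (p ^ k)) \<le> B"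
    if k: "1 \<le> k" "k \<le> 2" for k
  proof -
    have "\<exists>K. \<forall>H R. 1 \<le> H \<and> H \<le> R \<longrightarrow>
        real (card {(h, p). h \<in> box 9 H \<and> prime p \<and> R < real p \<and> real p \<le> 2 * R \<and>
                            rank_mod p 9 c h \<le> r})
          \<le> K * H ^ r * R powr (1 + 1 / 8)" if "r \<le> 9" for r
      by (rule hyp[rule_format, OF that]) simp
    note bound = dyadic_prime_power_bound[OF sym _ _ k this]
    obtain K where K: "K \<ge> 0" "\<And>R :: nat. 3 \<le> R \<Longrightarrow>
        (\<Sum>p | prime p \<and> R < p \<and> p \<le> 2 * R. ?F (p ^ k))
          \<le> K * real R powr (real k * (1 - real 9 / 4) + (1 + 1 / 8))"
      using bound by auto
    \<comment> \<open>With n = 9 and \<epsilon> = 1/8 the exponent of R is -1/8 for k = 1 and -11/8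
      for k = 2, so the ratio 2^(-1/8) serves both.\<close>
    define x :: real where "x = 2 powr (- 1 / 8)"
    have x: "0 \<le> x" "x < 1" unfolding x_def by (auto intro: powr_less_one)
    have dyadic: "(\<Sum>p | p \<in> {p. prime p} \<and> 2 ^ j < p \<and> p \<le> 2 * 2 ^ j. ?F (p ^ k)) \<le> K * x ^ j"
      if j: "2 \<le> j" for j
    proof -
      have "(2 :: nat) ^ 2 \<le> 2 ^ j" using j by (intro power_increasing) auto
      then have "(\<Sum>p | prime p \<and> 2 ^ j < p \<and> p \<le> 2 * 2 ^ j. ?F (p ^ k))
          \<le> K * real (2 ^ j) powr (real k * (1 - real 9 / 4) + (1 + 1 / 8))"
        by (intro K(2)) simp
      also have "\<dots> \<le> K * real (2 ^ j) powr (- 1 / 8)"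
        using k K(1) by (intro mult_left_mono powr_mono) auto
      also have "real (2 ^ j) powr (- 1 / 8) = x ^ j"
        by (simp add: x_def powr_realpow[symmetric] powr_powr mult.commute)
      finally show ?thesis by simp
    qed
    obtain B where "\<And>P. finite P \<Longrightarrow> P \<subseteq> {p. prime p} \<Longrightarrow> (\<Sum>p\<in>P. ?F (p ^ k)) \<le> B"
      using dyadic_sum_bounded[OF _ K(1) x dyadic] series_majorant_nonneg by blast
    then show ?thesis by blast
  qed
  obtain B1 where B1: "\<And>P. finite P \<Longrightarrow> P \<subseteq> {p. prime p} \<Longrightarrow> (\<Sum>p\<in>P. ?F (p ^ 1)) \<le> B1"
    using low[of 1] by auto
  obtain B2 where B2: "\<And>P. finite P \<Longrightarrow> P \<subseteq> {p. prime p} \<Longrightarrow> (\<Sum>p\<in>P. ?F (p ^ 2)) \<le> B2"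
    using low[of 2] by auto
  obtain C where C: "C \<ge> 0" "\<And>q. q > 0 \<Longrightarrow> ?F q \<le> C * real q powr (- 2 / 5)"
    using series_majorant_decay[OF sym geom] by blast
  obtain B3 where B3: "\<And>P m. finite P \<Longrightarrow> (\<And>p. p \<in> P \<Longrightarrow> prime p) \<Longrightarrow> (\<Sum>p\<in>P. \<Sum>k=3..m. ?F (p ^ k)) \<le> B3"
    using sum_higher_prime_powers_bounded[OF C] by blast
  have "summable ?F"
  proof (rule summable_submultiplicative)
    fix P :: "nat set" and m assume P: "finite P" "\<And>p. p \<in> P \<Longrightarrow> prime p"
    have "(\<Sum>k=1..m. ?F (p ^ k)) \<le> ?F (p ^ 1) + ?F (p ^ 2) + (\<Sum>k=3..m. ?F (p ^ k))" for p
    proof -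
      \<comment> \<open>This is an inequality rather than a splitting because \<open>m\<close> may
        be below 2.\<close>
      have "(\<Sum>k=1..m. ?F (p ^ k)) \<le> (\<Sum>k\<in>{1, 2} \<union> {3..m}. ?F (p ^ k))"
        by (intro sum_mono2) (auto simp: series_majorant_nonneg)
      also have "\<dots> = (\<Sum>k\<in>{1, 2}. ?F (p ^ k)) + (\<Sum>k=3..m. ?F (p ^ k))"
        by (intro sum.union_disjoint) auto
      finally show ?thesis by simp
    qed
    then have "(\<Sum>p\<in>P. \<Sum>k=1..m. ?F (p ^ k))
        \<le> (\<Sum>p\<in>P. ?F (p ^ 1) + ?F (p ^ 2) + (\<Sum>k=3..m. ?F (p ^ k)))"
      by (intro sum_mono)
    also have "\<dots> = (\<Sum>p\<in>P. ?F (p ^ 1)) + (\<Sum>p\<in>P. ?F (p ^ 2)) + (\<Sum>p\<in>P. \<Sum>k=3..m. ?F (p ^ k))"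
      by (simp only: sum.distrib)
    also have "\<dots> \<le> B1 + B2 + B3"
      using P by (intro add_mono B1 B2 B3) auto
    finally show "(\<Sum>p\<in>P. \<Sum>k=1..m. ?F (p ^ k)) \<le> B1 + B2 + B3" .
  qed (rule series_majorant_nonneg series_majorant_1_le series_majorant_mult_le; assumption)+
  then show ?thesis
  proof (rule summable_comparison_test'[where N = 0])
    fix q :: nat
    have "(\<Sum>a \<in> {a \<in> {1..q}. coprime a q}. cmod (S 9 c q a) / real q ^ 9)
        \<le> (\<Sum>a \<in> {a \<in> {1..q}. coprime a q}. max_S 9 c q / real q ^ 9)"
      by (intro sum_mono divide_right_mono norm_S_le_max_S) auto
    also have "\<dots> = real (card {a \<in> {1..q}. coprime a q}) * (max_S 9 c q / real q ^ 9)"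
      by simp
    also have "\<dots> \<le> real q * (max_S 9 c q / real q ^ 9)"
    proof (rule mult_right_mono)
      have "card {a \<in> {1..q}. coprime a q} \<le> card {1..q}" by (intro card_mono) auto
      then show "real (card {a \<in> {1..q}. coprime a q}) \<le> real q" by simp
    qed (simp add: max_S_nonneg)
    finally show "norm (\<Sum>a \<in> {a \<in> {1..q}. coprime a q}. cmod (S 9 c q a) / real q ^ 9) \<le> ?F q"
      by (simp add: series_majorant_def sum_nonneg)
  qed
qed

end
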